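(* Let $0<q<1$, let $z_n(s)=q^{-cn}/s$, and put $x_n(s)=(q^{-cn}/s-q^{cn}s)/2$ (that is, $x=(z-1/z)/2$ with $z=z_n(s)$). (a) If $c=2$, then $$\lim_{n\to\infty}(-st_2t_3)^nq^{n^2-n}V_n(x_n(s);t_1,t_2,t_3|q)=\frac{1}{(-q^2/t_1t_2,-q^2/t_2t_3;q)_\infty}\sum_{k=0}^\infty\frac{(-1)^kq^{k^2-2k}(st_1t_2t_3)^k}{(q;q)_k}=\frac{A_q(st_1t_2t_3q^{-2})}{(-q^2/t_1t_2,-q^2/t_2t_3;q)_\infty}.$$ (b) If $c>2$, then $$\lim_{n\to\infty}q^{(c-1)n^2-n}(-st_2t_3)^nV_n(x_n(s);t_1,t_2,t_3|q)=\frac{1}{(-q^2/t_1t_2,-q^2/t_2t_3;q)_\infty}.$$ (c) If $1\le c<2$, set $m=\lfloor cn/2\rfloor$ and $r=\{cn/2\}=cn/2-m$. For fixed $r$ and as $n\to\infty$, $$\lim_{n\to\infty}(-st_2t_3)^mq^{n+c^2n^2/4-2m}t_1^{m-n}V_n(x_n(s);t_1,t_2,t_3|q)=\frac{q^{r^2}\left(q^2,\ \dfrac{q^{3+2r}}{st_1t_2t_3},\ q^{-(1+2r)}st_1t_2t_3;q^2\right)_\infty}{(q,-q^2/t_1t_2,-q^2/t_2t_3;q)_\infty}.$$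
   Context: Notation: $(a;q)_n=\prod_{j=0}^{n-1}(1-aq^j)$, $(a;q)_\infty=\prod_{j\ge0}(1-aq^j)$, $(a_1,\dots,a_r;q)_n=\prod_i(a_i;q)_n$ (also for $n=\infty$ and with base $q^2$ in place of $q$), and ${}_3\phi_2\left(\begin{matrix}a_1,a_2,a_3\\ b_1,b_2\end{matrix}\Big|\,q,y\right)=\sum_{k\ge0}\frac{(a_1,a_2,a_3;q)_k}{(q,b_1,b_2;q)_k}y^k$. In $-q^2/t_1t_3$ etc. the denominator is the product $t_1t_3$. The parameters $t_1,t_2,t_3,s$ are such that the expressions are defined. For $x=(z-1/z)/2$ the polynomials $V_n$ (in $x$) are $$V_n(x;t_1,t_2,t_3|q)=\left(\frac{t_1}{q}\right)^n\frac{(-q^2/t_1t_3;q)_n}{(-q^2/t_2t_3;q)_n}\;{}_3\phi_2\left(\begin{matrix}q^{-n},\,-q/(t_1z),\,qz/t_1\\ -q^2/t_1t_3,\,-q^2/t_1t_2\end{matrix}\Big|\,q,\,-\frac{q^{n+2}}{t_2t_3}\right).$$ The Ramanujan ($q$-Airy) function is $A_q(z)=\sum_{n=0}^\infty\frac{q^{n^2}}{(q;q)_n}(-z)^n$.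
   Formalization: In (c) the factors q^{3+2r}/(st_1t_2t_3) and q^{-(1+2r)}st_1t_2t_3 are corrected to q^{3-2r}/(st_1t_2t_3) and q^{-(1-2r)}st_1t_2t_3; as printed the limit is wrong for r≠0 (at r=1/2 it is off by the factor -st_1t_2t_3/q^2). *)

theory Defs
  imports "HOL-Analysis.Analysis"
begin

definition qpoch :: "complex \<Rightarrow> real \<Rightarrow> nat \<Rightarrow> complex" where
  "qpoch a q n = (\<Prod>j<n. 1 - a * of_real q ^ j)"

definition qpoch_inf :: "complex \<Rightarrow> real \<Rightarrow> complex" where
  "qpoch_inf a q = (\<Prod>j. 1 - a * of_real q ^ j)"

definition phi32 ::
  "complex \<Rightarrow> complex \<Rightarrow> complex \<Rightarrow> complex \<Rightarrow> complex \<Rightarrow> real \<Rightarrow> complex \<Rightarrow> complex" where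
  "phi32 a1 a2 a3 b1 b2 q y =
     (\<Sum>k. (qpoch a1 q k * qpoch a2 q k * qpoch a3 q k) /
          (qpoch (of_real q) q k * qpoch b1 q k * qpoch b2 q k) * y ^ k)"

definition V_param ::
  "nat \<Rightarrow> complex \<Rightarrow> complex \<Rightarrow> complex \<Rightarrow> complex \<Rightarrow> real \<Rightarrow> complex" where
  "V_param n z t1 t2 t3 q =
     (t1 / of_real q) ^ n *
     (qpoch (- (of_real q ^ 2) / (t1 * t3)) q n / qpoch (- (of_real q ^ 2) / (t2 * t3)) q n) *
     phi32 (of_real (q powi (- int n))) (- of_real q / (t1 * z)) (of_real q * z / t1)
       (- (of_real q ^ 2) / (t1 * t3)) (- (of_real q ^ 2) / (t1 * t2)) q
       (- (of_real q ^ (n + 2)) / (t2 * t3))"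

text \<open>\<open>V\<close> is a function of \<open>x = (z - 1/z)/2\<close>. The two solutions \<open>z\<close> and \<open>-1/z\<close> of this
  equation give the same value (lemma \<open>V_eq_V_param\<close> below), so the choice is immaterial.\<close>

definition V :: "nat \<Rightarrow> complex \<Rightarrow> complex \<Rightarrow> complex \<Rightarrow> complex \<Rightarrow> real \<Rightarrow> complex" where
  "V n x t1 t2 t3 q = V_param n (SOME z. z \<noteq> 0 \<and> x = (z - 1 / z) / 2) t1 t2 t3 q"

lemma V_param_symmetric:
  assumes "z \<noteq> 0"
  shows "V_param n (- 1 / z) t1 t2 t3 q = V_param n z t1 t2 t3 q"
proof -
  have a: "- of_real q / (t1 * (- 1 / z)) = of_real q * z / t1"
    and b: "of_real q * (- 1 / z) / t1 = - of_real q / (t1 * z)"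
    using assms by (simp_all add: field_simps)
  show ?thesis
    unfolding V_param_def a b phi32_def by (simp add: ac_simps)
qed

lemma V_eq_V_param:
  assumes "z \<noteq> 0"
  shows "V n ((z - 1 / z) / 2) t1 t2 t3 q = V_param n z t1 t2 t3 q"
proof -
  define w where "w = (SOME w. w \<noteq> 0 \<and> (z - 1 / z) / 2 = (w - 1 / w) / 2)"
  have w: "w \<noteq> 0 \<and> (z - 1 / z) / 2 = (w - 1 / w) / 2"
    unfolding w_def by (rule someI[of _ z]) (use assms in simp)
  hence "z - 1 / z = w - 1 / w"
    by (metis divide_cancel_right zero_neq_numeral)
  hence "(z - 1 / z) * (z * w) = (w - 1 / w) * (z * w)" by simp
  moreover have "(z - 1 / z) * (z * w) = z * z * w - w" "(w - 1 / w) * (z * w) = w * w * z - z"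
    using assms w by (simp_all add: left_diff_distrib)
  ultimately have "(z - w) * (z * w + 1) = 0" by (simp add: algebra_simps)
  hence "z - w = 0 \<or> z * w + 1 = 0" by (simp only: mult_eq_0_iff)
  hence "w = z \<or> w = - 1 / z"
  proof
    assume "z * w + 1 = 0"
    hence "w * z = - 1" by (metis eq_neg_iff_add_eq_0 mult.commute)
    hence "w = - 1 / z" by (metis assms nonzero_eq_divide_eq)
    thus ?thesis by blast
  qed simp
  hence "V_param n w t1 t2 t3 q = V_param n z t1 t2 t3 q"
    using V_param_symmetric[OF assms] by auto
  thus ?thesis unfolding V_def w_def .
qed

definition q_Airy :: "real \<Rightarrow> complex \<Rightarrow> complex" where
  "q_Airy q z = (\<Sum>n. of_real (q ^ (n ^ 2)) / qpoch (of_real q) q n * (- z) ^ n)"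

definition z_seq :: "real \<Rightarrow> real \<Rightarrow> complex \<Rightarrow> nat \<Rightarrow> complex" where
  "z_seq q c s n = of_real (q powr (- c * real n)) / s"

definition x_seq :: "real \<Rightarrow> real \<Rightarrow> complex \<Rightarrow> nat \<Rightarrow> complex" where
  "x_seq q c s n = (of_real (q powr (- c * real n)) / s - of_real (q powr (c * real n)) * s) / 2"

lemma x_seq_eq:
  assumes "s \<noteq> 0"
  shows "x_seq q c s n = (z_seq q c s n - 1 / z_seq q c s n) / 2"
  using assms by (simp add: x_seq_def z_seq_def powr_minus of_real_inverse field_simps)

end

theory Submission
  imports Defs
begin

text \<open>
  The series for \<open>V\<^sub>n\<close> terminates at \<open>k = n\<close>. Turning around the two factors
  \<open>(q\<^sup>-\<^sup>n; q)\<^sub>k\<close> and \<open>(q z / t\<^sub>1; q)\<^sub>k\<close> shows that its \<open>k\<close>-th term is a bounded,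
  convergent quantity times the Gaussian weight \<open>q\<close> to the power \<open>k\<^sup>2 + 2 k - c n k\<close>, whose
  exponent is smallest near \<open>k = c n / 2\<close>. For \<open>c \<ge> 2\<close> the dominant terms sit at the end
  \<open>k = n\<close>, and the limit is a one-sided sum in \<open>n - k\<close>, which reduces to its first term if
  \<open>c > 2\<close>. For \<open>c < 2\<close> they sit in the interior, and the limit is a theta series in
  \<open>k - \<lfloor>c n / 2\<rfloor>\<close>, which the Jacobi triple product evaluates. Both limits are instances of
  dominated convergence; the same argument derives the triple product from the finite
  \<open>q\<close>-binomial theorem.
\<close>

subsection \<open>q-shifted factorials and the q-binomial theorem\<close>

lemma qpoch_0 [simp]: "qpoch a q 0 = 1"
  by (simp add: qpoch_def)

lemma qpoch_Suc: "qpoch a q (Suc n) = qpoch a q n * (1 - a * of_real q ^ n)"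
  by (simp add: qpoch_def)

text \<open>Termwise comparison with the product of \<open>1 + norm a * q ^ j\<close>, which is at
  most the exponential of a geometric series. The bound does not depend on the length
  \<open>n\<close> and vanishes with \<open>a\<close>. The first fact gives
  \<open>norm_qpoch_le\<close>, the second \<open>tendsto_qpoch_1\<close>.\<close>

lemma norm_qpoch_minus_1_le:
  assumes "0 < q" "q < 1"
  shows "norm (qpoch a q n - 1) \<le> exp (norm a / (1 - q)) - 1"
proof -
  have "norm (qpoch a q n - 1) = norm ((\<Prod>j<n. 1 + - (a * of_real q ^ j)) - 1)"
    by (simp add: qpoch_def)
  also have "\<dots> \<le> (\<Prod>j<n. 1 + norm (- (a * of_real q ^ j))) - 1"
    by (rule norm_prod_minus1_le_prod_minus1)
  also have "\<dots> = (\<Prod>j<n. 1 + norm a * q ^ j) - 1"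
    using assms by (simp add: norm_mult norm_power)
  also have "(\<Prod>j<n. 1 + norm a * q ^ j) \<le> exp (\<Sum>j<n. norm a * q ^ j)"
    by (rule prod_le_exp_sum) (use assms in auto)
  also have "(\<Sum>j<n. norm a * q ^ j) \<le> (\<Sum>j. norm a * q ^ j)"
    using assms by (intro sum_le_suminf summable_mult summable_geometric) auto
  also have "\<dots> = norm a / (1 - q)"
    using assms by (simp add: suminf_mult suminf_geometric summable_geometric)
  finally show ?thesis by simp
qed

lemma norm_qpoch_le:
  assumes "0 < q" "q < 1" "norm a \<le> R"
  shows "norm (qpoch a q n) \<le> exp (R / (1 - q))"
proof -
  have "norm (qpoch a q n) \<le> norm (qpoch a q n - 1) + 1"
    using norm_triangle_ineq[of "qpoch a q n - 1" 1] by simp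
  also have "\<dots> \<le> exp (norm a / (1 - q))"
    using norm_qpoch_minus_1_le[OF assms(1,2), of a n] by simp
  also have "\<dots> \<le> exp (R / (1 - q))"
    using assms by (simp add: divide_right_mono)
  finally show ?thesis .
qed

text \<open>The length \<open>k n\<close> may vary with \<open>n\<close> in any way, because the
  bound on the distance to 1 is uniform in the length.\<close>

lemma tendsto_qpoch_1:
  assumes "0 < q" "q < 1" "(a \<longlongrightarrow> 0) F"
  shows "((\<lambda>n. qpoch (a n) q (k n)) \<longlongrightarrow> 1) F"
proof (rule Lim_null_comparison[THEN Lim_null[THEN iffD2]])
  show "\<forall>\<^sub>F n in F. norm (qpoch (a n) q (k n) - 1) \<le> exp (norm (a n) / (1 - q)) - 1"
    using norm_qpoch_minus_1_le[OF assms(1,2)] by simp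
  have "((\<lambda>n. exp (norm (a n) / (1 - q)) - 1) \<longlongrightarrow> exp (norm (0::complex) / (1 - q)) - 1) F"
    using assms by (intro tendsto_intros) auto
  thus "((\<lambda>n. exp (norm (a n) / (1 - q)) - 1) \<longlongrightarrow> 0) F" by simp
qed

lemma convergent_prod_qpoch:
  fixes a :: complex
  assumes "0 < q" "q < 1"
  shows "convergent_prod (\<lambda>j. 1 - a * of_real q ^ j)"
proof -
  have "summable (\<lambda>j. norm (1 - a * of_real q ^ j - 1))"
    using assms by (simp add: norm_mult norm_power summable_mult summable_geometric)
  thus ?thesis
    using abs_convergent_prod_conv_summable abs_convergent_prod_imp_convergent_prod by blast
qed

lemma qpoch_LIMSEQ:
  assumes "0 < q" "q < 1"
  shows "(\<lambda>n. qpoch a q n) \<longlonglongrightarrow> qpoch_inf a q"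
  using convergent_prod_LIMSEQ[OF convergent_prod_qpoch[OF assms]]
  by (simp add: qpoch_def qpoch_inf_def LIMSEQ_lessThan_iff_atMost)

lemma qpoch_inf_nonzero:
  assumes "0 < q" "q < 1" "\<And>k. qpoch a q k \<noteq> 0"
  shows "qpoch_inf a q \<noteq> 0"
  unfolding qpoch_inf_def
proof (rule prodinf_nonzero[OF convergent_prod_qpoch[OF assms(1,2)]])
  show "1 - a * of_real q ^ j \<noteq> 0" for j
    using assms(3)[of "Suc j"] by (simp add: qpoch_Suc)
qed

text \<open>If no finite product vanishes, then no factor does, so the infinite product is nonzero.
  The inverses therefore converge, and a convergent sequence is bounded. This controls every
  denominator in the dominated convergence arguments.\<close>

lemma bounded_inverse_qpoch:
  assumes "0 < q" "q < 1" "\<And>k. qpoch a q k \<noteq> 0"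
  shows "\<exists>K>0. \<forall>n. norm (inverse (qpoch a q n)) \<le> K"
proof -
  have "(\<lambda>n. inverse (qpoch a q n)) \<longlonglongrightarrow> inverse (qpoch_inf a q)"
    by (intro tendsto_inverse qpoch_LIMSEQ qpoch_inf_nonzero assms)
  hence "Bseq (\<lambda>n. inverse (qpoch a q n))"
    by (intro convergent_imp_Bseq convergentI)
  thus ?thesis by (simp add: Bseq_def)
qed

lemma qpoch_self_nonzero:
  assumes "0 < q" "q < 1"
  shows "qpoch (of_real q) q k \<noteq> 0"
proof -
  have "1 - complex_of_real q * of_real q ^ j \<noteq> 0" for j
  proof -
    have "q ^ Suc j \<noteq> 1" using power_Suc_less_one[OF assms, of j] by simp
    hence "complex_of_real (q ^ Suc j) \<noteq> 1" by (metis of_real_eq_1_iff)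
    thus ?thesis by simp
  qed
  thus ?thesis by (simp add: qpoch_def)
qed

text \<open>Induction on \<open>N\<close>: multiplication by the new factor
  \<open>1 + x * q ^ N\<close> turns the coefficients for \<open>N\<close> into those for
  \<open>Suc N\<close> by the q-Pascal rule.\<close>

theorem q_binomial:
  assumes "0 < q" "q < 1"
  shows "qpoch (- x) q N = (\<Sum>k\<le>N. of_real q ^ (k choose 2) * x ^ k *
           (qpoch (of_real q) q N / (qpoch (of_real q) q k * qpoch (of_real q) q (N - k))))"
proof (induction N)
  case (Suc N)
  define Q where "Q = complex_of_real q"
  define p where "p = qpoch Q q"
  \<comment> \<open>Padding with 0 beyond \<open>k = N\<close> lets the Pascal rule hold at the
    boundary \<open>k = N\<close> as well, and lets the sum up to \<open>N\<close> be extended to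
    \<open>Suc N\<close> at no cost.\<close>
  define e where "e N k = (if k \<le> N then Q ^ (k choose 2) * (p N / (p k * p (N - k))) else 0)" for N k
  have nz: "p k \<noteq> 0" for k
    unfolding p_def Q_def by (rule qpoch_self_nonzero[OF assms])
  have p_Suc: "p (Suc k) = p k * (1 - Q ^ Suc k)" for k
    by (simp add: p_def qpoch_Suc Q_def)
  have p0: "p 0 = 1" by (simp add: p_def)
  have e0: "e N 0 = 1" for N
    using nz by (simp add: e_def p0 numeral_2_eq_2)
  have pascal: "e (Suc N) (Suc k) = e N (Suc k) + Q ^ N * e N k" if "k \<le> N" for k
  proof (cases "k = N")
    case True
    have "e (Suc N) (Suc N) = Q ^ (Suc N choose 2)" "e N N = Q ^ (N choose 2)" "e N (Suc N) = 0"
      using nz by (simp_all add: e_def p0)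
    thus ?thesis using True by (simp add: numeral_2_eq_2 power_add)
  next
    case False
    define l where "l = N - Suc k"
    have N: "N = Suc (k + l)" using that False by (simp add: l_def)
    have ch: "Suc k choose 2 = (k choose 2) + k" by (simp add: numeral_2_eq_2)
    have nzf: "1 - Q ^ Suc k \<noteq> 0" for k using nz[of "Suc k"] p_Suc[of k] by auto
    \<comment> \<open>With \<open>N = k + l + 1\<close>, all common factors go into
      \<open>C\<close>. What remains of the Pascal rule is the partial fraction identity (1 - XY) /
      ((1 - X)(1 - Y)) = 1/(1 - X) + Y/(1 - Y).\<close>
    define X Y C where "X = Q ^ Suc k" and "Y = Q ^ Suc l"
      and "C = Q ^ (k choose 2) * Q ^ k * (p N / (p k * p l))"
    have nzX: "1 - X \<noteq> 0" and nzY: "1 - Y \<noteq> 0" by (simp_all only: X_def Y_def nzf not_False_eq_True)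
    have QN: "Q ^ N = Q ^ k * Y" "Q ^ Suc N = X * Y"
      by (simp_all add: N X_def Y_def power_add)
    have "p (Suc N) = p N * (1 - X * Y)" "p (Suc k) = p k * (1 - X)" "p (Suc l) = p l * (1 - Y)"
      by (simp_all only: p_Suc QN X_def Y_def)
    note p = this
    have diffs: "Suc N - Suc k = Suc l" "N - Suc k = l" "N - k = Suc l" by (simp_all add: N)
    have le: "Suc k \<le> Suc N" "Suc k \<le> N" "k \<le> N" by (simp_all add: N)
    have "e (Suc N) (Suc k) = C * ((1 - X * Y) / ((1 - X) * (1 - Y)))"
      unfolding e_def diffs p ch C_def if_P[OF le(1)] by (simp add: power_add mult_ac)
    also have "(1 - X * Y) / ((1 - X) * (1 - Y)) = 1 / (1 - X) + Y / (1 - Y)"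
      using nzX nzY by (simp add: add_frac_eq) (simp add: algebra_simps)
    also have "C * \<dots> = C * (1 / (1 - X)) + C * (Y / (1 - Y))"
      by (rule distrib_left)
    also have "C * (1 / (1 - X)) = e N (Suc k)"
      unfolding e_def diffs p ch C_def if_P[OF le(2)] by (simp add: power_add mult_ac)
    also have "C * (Y / (1 - Y)) = Q ^ N * e N k"
      unfolding e_def diffs p C_def if_P[OF le(3)] QN by (simp add: mult_ac)
    finally show ?thesis .
  qed
  have "qpoch (- x) q (Suc N) = (\<Sum>k\<le>N. e N k * x ^ k) * (1 + x * Q ^ N)"
    unfolding qpoch_Suc Suc.IH by (simp add: e_def p_def Q_def mult_ac)
  also have "\<dots> = (\<Sum>k\<le>N. e N k * x ^ k) + (\<Sum>k\<le>N. Q ^ N * e N k * x ^ Suc k)"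
    by (simp add: algebra_simps sum_distrib_left sum_distrib_right sum.distrib)
  also have "(\<Sum>k\<le>N. e N k * x ^ k) = (\<Sum>k\<le>Suc N. e N k * x ^ k)"
    by (simp add: e_def)
  also have "\<dots> = e N 0 + (\<Sum>k\<le>N. e N (Suc k) * x ^ Suc k)"
    by (simp add: sum.atMost_Suc_shift del: sum.atMost_Suc)
  also have "\<dots> + (\<Sum>k\<le>N. Q ^ N * e N k * x ^ Suc k)
      = e (Suc N) 0 + (\<Sum>k\<le>N. e (Suc N) (Suc k) * x ^ Suc k)"
    by (simp add: e0 pascal ring_distribs flip: sum.distrib)
  also have "\<dots> = (\<Sum>k\<le>Suc N. e (Suc N) k * x ^ k)"
    by (simp add: sum.atMost_Suc_shift del: sum.atMost_Suc)
  also have "\<dots> = (\<Sum>k\<le>Suc N. Q ^ (k choose 2) * x ^ k * (p (Suc N) / (p k * p (Suc N - k))))"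
    by (rule sum.cong) (simp_all add: e_def)
  finally show ?case by (simp only: p_def Q_def)
qed (simp add: numeral_2_eq_2)

subsection \<open>Dominated convergence and the Jacobi triple product\<close>

lemma filterlim_nat_int_add:
  assumes "filterlim m at_top F"
  shows "filterlim (\<lambda>n. nat (int (m n) + j)) at_top F"
  unfolding filterlim_at_top
proof
  fix Z
  have "\<forall>\<^sub>F n in F. Z + nat \<bar>j\<bar> \<le> m n" using assms by (simp add: filterlim_at_top)
  thus "\<forall>\<^sub>F n in F. Z \<le> nat (int (m n) + j)" by eventually_elim linarith
qed

text \<open>Dominated convergence for finite sums recentred at a moving index \<open>m n\<close>,
  with unboundedly many terms on both sides of it. Pairing the offsets \<open>i\<close> and
  \<open>- (i + 1)\<close> folds the two-sided sum into a one-sided series, to which Tannery's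
  theorem applies. The filter is kept general because the case \<open>c < 2\<close> needs
  \<open>n\<close> confined to a set of indices.\<close>

lemma bilateral_tannery:
  fixes g :: "'n \<Rightarrow> nat \<Rightarrow> 'a :: {real_normed_algebra, banach}"
  assumes F: "F \<noteq> bot"
    and m: "filterlim m at_top F" and N: "filterlim (\<lambda>n. N n - m n) at_top F"
    and lim: "\<And>j::int. ((\<lambda>n. g n (nat (int (m n) + j))) \<longlongrightarrow> G j) F"
    and bound: "\<forall>\<^sub>F n in F. \<forall>k\<le>N n. norm (g n k) \<le> h (int k - int (m n))"
    and h: "\<And>j. 0 \<le> h j" "summable (\<lambda>i. h (int i))" "summable (\<lambda>i. h (- int (Suc i)))"
  shows "((\<lambda>n. \<Sum>k\<le>N n. g n k) \<longlongrightarrow> (\<Sum>i. G (int i) + G (- int (Suc i)))) F"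
proof -
  \<comment> \<open>The guards discard offsets that leave the range from 0 to \<open>N n\<close>.
    The second one also prevents the truncated subtraction \<open>m n - Suc i\<close> from counting
    the term at 0 repeatedly.\<close>
  define a where "a i n = (if m n + i \<le> N n then g n (m n + i) else 0) +
      (if i < m n then g n (m n - Suc i) else 0)" for i n
  have mN: "\<forall>\<^sub>F n in F. m n + i \<le> N n" for i
  proof -
    have "\<forall>\<^sub>F n in F. i + 1 \<le> N n - m n"
      using N by (simp add: filterlim_at_top)
    thus ?thesis by eventually_elim simp
  qed
  have lim': "((\<lambda>n. a i n) \<longlongrightarrow> G (int i) + G (- int (Suc i))) F" for i
  proof (rule Lim_transform_eventually)
    show "((\<lambda>n. g n (nat (int (m n) + int i)) + g n (nat (int (m n) + - int (Suc i)))) \<longlongrightarrow>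
        G (int i) + G (- int (Suc i))) F"
      by (intro tendsto_add lim)
    have "\<forall>\<^sub>F n in F. i + 1 \<le> m n" using m by (simp add: filterlim_at_top)
    thus "\<forall>\<^sub>F n in F. g n (nat (int (m n) + int i)) + g n (nat (int (m n) + - int (Suc i))) = a i n"
      using mN[of i]
    proof eventually_elim
      case (elim n)
      hence "nat (int (m n) + int i) = m n + i" "nat (int (m n) + - int (Suc i)) = m n - Suc i"
        by linarith+
      thus ?case using elim by (simp add: a_def)
    qed
  qed
  have bd: "\<forall>\<^sub>F (i, n) in at_top \<times>\<^sub>F F. norm (a i n) \<le> h (int i) + h (- int (Suc i))"
  proof -
    have "\<forall>\<^sub>F n in F. \<forall>i. norm (a i n) \<le> h (int i) + h (- int (Suc i))"
      using bound mN[of 0]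
    proof eventually_elim
      case (elim n)
      show ?case
      proof
        fix i
        have "norm (if m n + i \<le> N n then g n (m n + i) else 0) \<le> h (int i)"
          using elim(1)[rule_format, of "m n + i"] h(1)[of "int i"] by auto
        moreover have "norm (if i < m n then g n (m n - Suc i) else 0) \<le> h (- int (Suc i))"
          using elim(1)[rule_format, of "m n - Suc i"] elim(2) h(1)[of "- int (Suc i)"]
          by (auto simp: of_nat_diff)
        ultimately show "norm (a i n) \<le> h (int i) + h (- int (Suc i))"
          unfolding a_def by (rule norm_triangle_mono)
      qed
    qed
    \<comment> \<open>The domination holds for all \<open>i\<close> at once, so the trivial
      condition \<open>True\<close> suffices on the index component of the product filter.\<close>
    hence "\<forall>\<^sub>F x in at_top \<times>\<^sub>F F. True \<and>
        (\<forall>i. norm (a i (snd x)) \<le> h (int i) + h (- int (Suc i)))"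
      by (intro eventually_prodI) auto
    thus ?thesis by eventually_elim auto
  qed
  have "((\<lambda>n. \<Sum>i. a i n) \<longlongrightarrow> (\<Sum>i. G (int i) + G (- int (Suc i)))) F"
    using tannerys_theorem[OF lim' bd summable_add[OF h(2,3)] F] by blast
  moreover have "\<forall>\<^sub>F n in F. (\<Sum>i. a i n) = (\<Sum>k\<le>N n. g n k)"
    using mN[of 0]
  proof eventually_elim
    case (elim n)
    define d where "d = N n - m n"
    have d: "N n = m n + d" using elim by (simp add: d_def)
    have "(\<lambda>i. if i \<in> {..d} then g n (m n + i) else 0) sums (\<Sum>i\<le>d. g n (m n + i))"
      by (rule sums_If_finite_set) simp
    moreover have "(\<lambda>i. if i \<in> {..<m n} then g n (m n - Suc i) else 0) sums (\<Sum>i<m n. g n (m n - Suc i))"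
      by (rule sums_If_finite_set) simp
    ultimately have "(\<lambda>i. a i n) sums ((\<Sum>i\<le>d. g n (m n + i)) + (\<Sum>i<m n. g n (m n - Suc i)))"
      unfolding a_def d by (auto dest: sums_add simp: add_left_mono)
    hence "(\<Sum>i. a i n) = (\<Sum>i\<le>d. g n (m n + i)) + (\<Sum>i<m n. g n (m n - Suc i))"
      by (rule sums_unique[symmetric])
    also have "(\<Sum>i<m n. g n (m n - Suc i)) = (\<Sum>i<m n. g n i)"
      by (rule sum.nat_diff_reindex)
    also have "(\<Sum>i\<le>d. g n (m n + i)) + \<dots> = (\<Sum>k\<le>N n. g n k)"
    proof -
      have "(\<Sum>i\<le>l. g n (m n + i)) + (\<Sum>i<m n. g n i) = (\<Sum>k\<le>m n + l. g n k)" for l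
        by (induction l) (simp_all add: add_ac flip: lessThan_Suc_atMost)
      thus ?thesis by (simp add: d)
    qed
    finally show ?case .
  qed
  ultimately show ?thesis by (rule Lim_transform_eventually)
qed

text \<open>The square beats the linear term: once \<open>i\<close> is at least
  \<open>1 - b\<close>, the exponent is at least \<open>i\<close>, and a geometric series
  dominates.\<close>

lemma summable_powr_quadratic:
  fixes q b :: real
  assumes "0 < q" "q < 1"
  shows "summable (\<lambda>i. q powr (real i ^ 2 + b * real i))"
proof (rule summable_comparison_test')
  show "summable (\<lambda>i. q ^ i)" using assms by (simp add: summable_geometric)
  fix i assume "nat \<lceil>1 - b\<rceil> \<le> i"
  hence "1 - b \<le> real i" by linarith
  hence "(1 - b) * real i \<le> real i * real i" by (intro mult_right_mono) auto
  hence "real i \<le> real i ^ 2 + b * real i" by (simp add: algebra_simps power2_eq_square)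
  hence "q powr (real i ^ 2 + b * real i) \<le> q powr real i"
    using assms by (intro powr_mono') auto
  thus "norm (q powr (real i ^ 2 + b * real i)) \<le> q ^ i"
    using assms by (simp add: powr_realpow)
qed

lemma summable_powr_quadratic_neg:
  fixes q b :: real
  assumes "0 < q" "q < 1"
  shows "summable (\<lambda>i. q powr (real_of_int (- int (Suc i)) ^ 2 + b * real_of_int (- int (Suc i))))"
proof -
  have "summable (\<lambda>i. q powr (real (Suc i) ^ 2 + (- b) * real (Suc i)))"
    using summable_powr_quadratic[OF assms, of "- b"] by (subst summable_Suc_iff)
  thus ?thesis by (simp add: power2_eq_square algebra_simps)
qed

text \<open>The q-binomial theorem in base \<open>q\<^sup>2\<close> with \<open>2 * n\<close>
  factors and x = w q^(1 - 2n). The factors are then 1 + w q^e with e running over the odd numbers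
  from 1 - 2n to 2n - 1. Those with positive e form the first product; from those with negative e,
  pulling out w q^e leaves the second.\<close>

lemma jacobi_triple_product_finite:
  fixes q :: real and w :: complex
  assumes q: "0 < q" "q < 1" and w: "w \<noteq> 0"
  defines "Q \<equiv> qpoch (of_real (q\<^sup>2)) (q\<^sup>2)"
  shows "qpoch (- of_real q * w) (q\<^sup>2) n * qpoch (- of_real q / w) (q\<^sup>2) n =
    (\<Sum>k\<le>2 * n. w powi (int k - int n) * of_real (q powr (real_of_int (int k - int n))\<^sup>2) *
      (Q (2 * n) / (Q k * Q (2 * n - k))))"
proof -
  define p where "p = complex_of_real q"
  have p: "p \<noteq> 0" using q by (simp add: p_def)
  define x where "x = w * p / p ^ (2 * n)"
  have "qpoch (- x) (q\<^sup>2) (2 * n) = (\<Prod>i<2*n. 1 + x * p ^ (2 * i))"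
    by (simp add: qpoch_def p_def power_mult)
  also have "\<dots> = (\<Prod>i<n. 1 + x * p ^ (2 * i)) * (\<Prod>i<n. 1 + x * p ^ (2 * (n + i)))"
  proof -
    have "prod f {..<n + m} = prod f {..<n} * (\<Prod>i<m. f (n + i))" for f :: "nat \<Rightarrow> complex" and m
      by (induction m) (simp_all add: mult_ac)
    thus ?thesis unfolding mult_2[of n] by blast
  qed
  also have "(\<Prod>i<n. 1 + x * p ^ (2 * (n + i))) = qpoch (- p * w) (q\<^sup>2) n"
    using p by (simp add: qpoch_def x_def p_def power_add distrib_left mult_ac flip: power_mult)
  also have "(\<Prod>i<n. 1 + x * p ^ (2 * i)) = (\<Prod>i<n. 1 + x * p ^ (2 * (n - Suc i)))"
    by (rule prod.nat_diff_reindex[symmetric])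
  also have "\<dots> = (\<Prod>i<n. w / p ^ (2 * i + 1) * (1 + p / w * p ^ (2 * i)))"
  proof (intro prod.cong refl)
    fix i assume "i \<in> {..<n}"
    hence "2 * n = 2 * (n - Suc i) + (2 * i + 1) + 1" by simp
    hence "p ^ (2 * n) = p ^ (2 * (n - Suc i)) * p ^ (2 * i + 1) * p"
      by (metis power_add power_one_right)
    hence "x * p ^ (2 * (n - Suc i)) = w / p ^ (2 * i + 1)"
      using p by (simp add: x_def)
    thus "1 + x * p ^ (2 * (n - Suc i)) = w / p ^ (2 * i + 1) * (1 + p / w * p ^ (2 * i))"
      using p w by (simp add: field_simps)
  qed
  also have "\<dots> = (\<Prod>i<n. w / p ^ (2 * i + 1)) * qpoch (- p / w) (q\<^sup>2) n"
    unfolding prod.distrib by (simp add: qpoch_def p_def power_mult)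
  \<comment> \<open>The first \<open>n\<close> odd numbers add up to the square of
    \<open>n\<close>.\<close>
  also have "(\<Prod>i<n. w / p ^ (2 * i + 1)) = w ^ n / p ^ (n\<^sup>2)"
    by (induction n) (simp_all add: power2_eq_square power_add power_mult mult_ac)
  finally have eq: "w ^ n / p ^ (n\<^sup>2) * (qpoch (- p * w) (q\<^sup>2) n * qpoch (- p / w) (q\<^sup>2) n)
      = qpoch (- x) (q\<^sup>2) (2 * n)"
    by (simp add: mult_ac)
  have "qpoch (- p * w) (q\<^sup>2) n * qpoch (- p / w) (q\<^sup>2) n
      = p ^ (n\<^sup>2) / w ^ n * qpoch (- x) (q\<^sup>2) (2 * n)"
    using p w by (subst eq[symmetric]) simp
  also have "\<dots> = (\<Sum>k\<le>2 * n. p ^ (n\<^sup>2) / w ^ n * ((p\<^sup>2) ^ (k choose 2) * x ^ k) *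
      (Q (2 * n) / (Q k * Q (2 * n - k))))"
  proof -
    have "0 < q\<^sup>2" "q\<^sup>2 < 1" using q by (simp_all add: power_less_one_iff abs_square_less_1)
    from q_binomial[OF this, of x "2 * n"] show ?thesis
      by (simp add: sum_distrib_left p_def Q_def mult_ac)
  qed
  also have "\<dots> = (\<Sum>k\<le>2 * n. w powi (int k - int n) *
      of_real (q powr (real_of_int (int k - int n))\<^sup>2) * (Q (2 * n) / (Q k * Q (2 * n - k))))"
  proof (rule sum.cong[OF refl], rule arg_cong2[where f = "(*)", OF _ refl])
    fix k
    \<comment> \<open>Twice \<open>k choose 2\<close> plus \<open>k\<close> is the square of
      \<open>k\<close>. Together with the prefactor and the \<open>p ^ (2 * n * k)\<close> from
      \<open>x ^ k\<close>, it completes the square of \<open>k - n\<close>.\<close>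
    have "(p\<^sup>2) ^ (k choose 2) * p ^ k = p ^ (k\<^sup>2)"
      by (induction k) (simp_all add: numeral_2_eq_2 power_add power_mult_distrib mult_ac)
    moreover have "x ^ k = w ^ k * p ^ k / p ^ (2 * n * k)"
      by (simp only: x_def power_divide power_mult_distrib power_mult)
    ultimately have "p ^ (n\<^sup>2) / w ^ n * ((p\<^sup>2) ^ (k choose 2) * x ^ k) =
        (w ^ k / w ^ n) * (p ^ (n\<^sup>2) * p ^ (k\<^sup>2) / p ^ (2 * n * k))"
      by (simp add: mult_ac)
    also have "w ^ k / w ^ n = w powi (int k - int n)"
      using w by (simp add: power_int_diff)
    also have "p ^ (n\<^sup>2) * p ^ (k\<^sup>2) / p ^ (2 * n * k) =
        of_real (q ^ (n\<^sup>2) * q ^ (k\<^sup>2) / q ^ (2 * n * k))"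
      by (simp add: p_def)
    also have "q ^ (n\<^sup>2) * q ^ (k\<^sup>2) / q ^ (2 * n * k)
        = q powr (real (n\<^sup>2) + real (k\<^sup>2) - real (2 * n * k))"
      using q by (simp add: powr_add powr_diff powr_realpow flip: of_nat_mult of_nat_power)
    also have "real (n\<^sup>2) + real (k\<^sup>2) - real (2 * n * k) = (real_of_int (int k - int n))\<^sup>2"
      by (simp add: power2_eq_square algebra_simps)
    finally show "p ^ (n\<^sup>2) / w ^ n * ((p\<^sup>2) ^ (k choose 2) * x ^ k) =
        w powi (int k - int n) * of_real (q powr (real_of_int (int k - int n))\<^sup>2)" .
  qed
  finally show ?thesis by (simp add: p_def)
qed

text \<open>Writing |w| as a power of \<open>q\<close> turns the modulus into a power with quadratic
  exponent, the shape needed for \<open>summable_powr_quadratic\<close>.\<close>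

lemma norm_theta_term:
  fixes q :: real and w :: complex
  assumes "0 < q" "q < 1" "w \<noteq> 0"
  shows "norm (w powi j * of_real (q powr (real_of_int j)\<^sup>2))
    = q powr ((real_of_int j)\<^sup>2 + log q (norm w) * real_of_int j)"
proof -
  have "norm w powi j = q powr (log q (norm w) * real_of_int j)"
    using assms by (simp add: powr_real_of_int' flip: powr_powr)
  thus ?thesis using assms by (simp add: norm_mult norm_power_int powr_add)
qed

text \<open>Both sides are limits of the finite version multiplied by \<open>Qinf\<close>. The
  products converge directly, and the sum converges by \<open>bilateral_tannery\<close> centred at
  \<open>k = n\<close>.\<close>

theorem jacobi_triple_product:
  fixes q :: real and w :: complex
  assumes q: "0 < q" "q < 1" and w: "w \<noteq> 0"
  defines "\<theta> \<equiv> \<lambda>j. w powi j * of_real (q powr (real_of_int j)\<^sup>2)"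
  shows "qpoch_inf (of_real (q\<^sup>2)) (q\<^sup>2) * qpoch_inf (- of_real q * w) (q\<^sup>2) *
    qpoch_inf (- of_real q / w) (q\<^sup>2) = (\<Sum>i. \<theta> (int i) + \<theta> (- int (Suc i)))"
proof (rule LIMSEQ_unique)
  define Q where "Q = qpoch (of_real (q\<^sup>2)) (q\<^sup>2)"
  define Qinf where "Qinf = qpoch_inf (of_real (q\<^sup>2)) (q\<^sup>2)"
  have q2: "0 < q\<^sup>2" "q\<^sup>2 < 1" using q by (simp_all add: power_less_one_iff abs_square_less_1)
  have nz: "Q k \<noteq> 0" for k unfolding Q_def by (rule qpoch_self_nonzero[OF q2])
  have Qlim: "Q \<longlonglongrightarrow> Qinf" unfolding Q_def Qinf_def by (rule qpoch_LIMSEQ[OF q2])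
  have Qnz: "Qinf \<noteq> 0"
    using qpoch_inf_nonzero[OF q2] nz unfolding Q_def Qinf_def by blast
  obtain K where K: "K > 0" "\<And>n. norm (inverse (Q n)) \<le> K"
    using bounded_inverse_qpoch[OF q2 nz[unfolded Q_def]] unfolding Q_def by blast
  define E where "E = exp (norm (complex_of_real (q\<^sup>2)) / (1 - q\<^sup>2))"
  have E: "norm (Q n) \<le> E" for n
    unfolding Q_def E_def by (rule norm_qpoch_le[OF q2]) simp
  \<comment> \<open>At \<open>k = n + j\<close> the ratio
    \<open>Q (2 * n) / (Q k * Q (2 * n - k))\<close> tends to \<open>1 / Qinf\<close>, so the extra
    \<open>Qinf\<close> normalises the termwise limit to \<open>\<theta> j\<close>.\<close>
  define g where "g n k = \<theta> (int k - int n) * (Qinf * Q (2 * n) / (Q k * Q (2 * n - k)))" for n k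
  define \<beta> where "\<beta> = log q (norm w)"
  define h where "h j = q powr ((real_of_int j)\<^sup>2 + \<beta> * real_of_int j) * (norm Qinf * E * K * K)" for j
  show "(\<lambda>n. \<Sum>k\<le>2 * n. g n k) \<longlonglongrightarrow> (\<Sum>i. \<theta> (int i) + \<theta> (- int (Suc i)))"
  proof (rule bilateral_tannery[where m = "\<lambda>n. n" and h = h])
    show "filterlim (\<lambda>n. 2 * n - n) at_top sequentially"
      using filterlim_ident by simp
    show "(\<lambda>n. g n (nat (int n + j))) \<longlonglongrightarrow> \<theta> j" for j
    proof (rule Lim_transform_eventually)
      have Q_shift: "(\<lambda>n. Q (nat (int n + j))) \<longlonglongrightarrow> Qinf" for j
        by (rule filterlim_compose[OF Qlim filterlim_nat_int_add[OF filterlim_ident]])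
      have "(\<lambda>n. Q (2 * n)) \<longlonglongrightarrow> Qinf"
        by (rule filterlim_compose[OF Qlim]) (rule filterlim_subseq, simp add: strict_mono_def)
      moreover from Q_shift[of j] Q_shift[of "- j"] have "(\<lambda>n. Q (nat (int n + j))) \<longlonglongrightarrow> Qinf"
        and "(\<lambda>n. Q (nat (int n - j))) \<longlonglongrightarrow> Qinf" by simp_all
      ultimately have "(\<lambda>n. \<theta> j * (Qinf * Q (2 * n) / (Q (nat (int n + j)) * Q (nat (int n - j))))) \<longlonglongrightarrow>
          \<theta> j * (Qinf * Qinf / (Qinf * Qinf))"
        using Qnz by (intro tendsto_intros) auto
      thus "(\<lambda>n. \<theta> j * (Qinf * Q (2 * n) / (Q (nat (int n + j)) * Q (nat (int n - j))))) \<longlonglongrightarrow> \<theta> j"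
        using Qnz by simp
      show "\<forall>\<^sub>F n in sequentially. \<theta> j * (Qinf * Q (2 * n) / (Q (nat (int n + j)) * Q (nat (int n - j))))
          = g n (nat (int n + j))"
        using eventually_ge_at_top[of "nat \<bar>j\<bar>"]
      proof eventually_elim
        case (elim n)
        hence "2 * n - nat (int n + j) = nat (int n - j)" "int (nat (int n + j)) - int n = j"
          by linarith+
        thus ?case by (simp only: g_def)
      qed
    qed
    show "\<forall>\<^sub>F n in sequentially. \<forall>k\<le>2 * n. norm (g n k) \<le> h (int k - int n)"
    proof (intro always_eventually allI impI)
      fix n k
      have "norm (g n k) = norm (\<theta> (int k - int n)) * (norm Qinf * norm (Q (2 * n)) *
          norm (inverse (Q k)) * norm (inverse (Q (2 * n - k))))"
        by (simp add: g_def norm_mult norm_divide norm_inverse field_simps)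
      also have "norm (\<theta> (int k - int n)) =
          q powr ((real_of_int (int k - int n))\<^sup>2 + \<beta> * real_of_int (int k - int n))"
        unfolding \<theta>_def \<beta>_def by (rule norm_theta_term[OF q w])
      also have "\<dots> * (norm Qinf * norm (Q (2 * n)) *
          norm (inverse (Q k)) * norm (inverse (Q (2 * n - k)))) \<le> h (int k - int n)"
        unfolding h_def by (intro mult_left_mono mult_mono K E) (use K(1) in \<open>auto simp: E_def\<close>)
      finally show "norm (g n k) \<le> h (int k - int n)" .
    qed
    show "0 \<le> h j" for j using K(1) by (simp add: h_def E_def)
    show "summable (\<lambda>i. h (int i))"
      unfolding h_def using summable_powr_quadratic[OF q, of \<beta>] by (intro summable_mult2) simp
    show "summable (\<lambda>i. h (- int (Suc i)))"
      unfolding h_def by (intro summable_mult2 summable_powr_quadratic_neg[OF q])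
  qed (use filterlim_ident in auto)
  have "(\<Sum>k\<le>2 * n. g n k) = Qinf *
      (qpoch (- of_real q * w) (q\<^sup>2) n * qpoch (- of_real q / w) (q\<^sup>2) n)" for n
    unfolding jacobi_triple_product_finite[OF q w] sum_distrib_left g_def \<theta>_def Q_def
    by (simp add: mult_ac)
  moreover have "(\<lambda>n. Qinf * (qpoch (- of_real q * w) (q\<^sup>2) n * qpoch (- of_real q / w) (q\<^sup>2) n)) \<longlonglongrightarrow>
      Qinf * (qpoch_inf (- of_real q * w) (q\<^sup>2) * qpoch_inf (- of_real q / w) (q\<^sup>2))"
    by (intro tendsto_intros qpoch_LIMSEQ q2)
  ultimately show "(\<lambda>n. \<Sum>k\<le>2 * n. g n k) \<longlonglongrightarrow> qpoch_inf (of_real (q\<^sup>2)) (q\<^sup>2) *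
      qpoch_inf (- of_real q * w) (q\<^sup>2) * qpoch_inf (- of_real q / w) (q\<^sup>2)"
    by (simp add: Qinf_def mult_ac)
qed

subsection \<open>Asymptotics of the polynomials\<close>

text \<open>The part of the \<open>k\<close>-th term that stays bounded and converges, apart from the
  factor \<open>1 / (q; q)\<close> of index \<open>n - k\<close>.\<close>

definition V_coeff ::
  "real \<Rightarrow> real \<Rightarrow> complex \<Rightarrow> complex \<Rightarrow> complex \<Rightarrow> complex \<Rightarrow> nat \<Rightarrow> nat \<Rightarrow> complex" where
  "V_coeff q c s t1 t2 t3 n k =
     qpoch (of_real q) q n / qpoch (of_real q) q k *
     (qpoch (- (of_real q ^ 2) / (t1 * t3)) q n / qpoch (- (of_real q ^ 2) / (t1 * t3)) q k) *
     qpoch (of_real (q powr (c * real n - real k)) * (s * t1)) q k *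
     qpoch (- of_real (q powr (c * real n + 1)) * s / t1) q k /
     (qpoch (- (of_real q ^ 2) / (t1 * t2)) q k * qpoch (- (of_real q ^ 2) / (t2 * t3)) q n)"

text \<open>Factor by factor, \<open>1 - u = - u (1 - 1 / u)\<close> for the factors in which \<open>u\<close> grows with \<open>n\<close>.\<close>

lemma qpoch_reflect:
  fixes q c :: real and s t1 t2 t3 :: complex
  assumes q: "0 < q" "q < 1" and nz: "t1 \<noteq> 0" "t2 \<noteq> 0" "t3 \<noteq> 0" "s \<noteq> 0" and "k \<le> n"
  shows "qpoch (of_real (q powi (- int n))) q k * qpoch (of_real (q powr (1 - c * real n)) / (s * t1)) q k *
      (- (of_real q ^ (n + 2)) / (t2 * t3)) ^ k =
    (- 1 / (s * t1 * t2 * t3)) ^ k * of_real (q powr (real k ^ 2 + 2 * real k - c * real n * real k)) *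
      (qpoch (of_real q) q n / qpoch (of_real q) q (n - k)) *
      qpoch (of_real (q powr (c * real n - real k)) * (s * t1)) q k"
proof -
  define Q where "Q = qpoch (of_real q) q"
  \<comment> \<open>The product in reversed order. Its factors do not depend on \<open>k\<close>,
    whereas the base of the corresponding \<open>qpoch\<close> does, so only this form grows by one
    factor in the induction on \<open>k\<close>.\<close>
  define R where "R k = (\<Prod>j<k. 1 - of_real (q powr (c * real n - 1 - real j)) * (s * t1))" for k
  have "qpoch (of_real (q powr (c * real n - real k)) * (s * t1)) q k
      = (\<Prod>j<k. 1 - of_real (q powr (c * real n - 1 - real (k - Suc j))) * (s * t1))"
    unfolding qpoch_def
  proof (intro prod.cong refl)
    fix j assume "j \<in> {..<k}"
    hence "q powr (c * real n - 1 - real (k - Suc j)) = q powr (c * real n - real k + real j)"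
      by (simp add: of_nat_diff algebra_simps)
    also have "\<dots> = q powr (c * real n - real k) * q ^ j"
      using q by (simp add: powr_add powr_realpow)
    finally show "1 - of_real (q powr (c * real n - real k)) * (s * t1) * of_real q ^ j =
        1 - of_real (q powr (c * real n - 1 - real (k - Suc j))) * (s * t1)"
      by (simp add: mult_ac)
  qed
  also have "\<dots> = R k" unfolding R_def by (rule prod.nat_diff_reindex)
  finally have R: "qpoch (of_real (q powr (c * real n - real k)) * (s * t1)) q k = R k" .
  have Qnz: "Q k \<noteq> 0" for k unfolding Q_def by (rule qpoch_self_nonzero[OF q])
  from \<open>k \<le> n\<close> have "qpoch (of_real (q powi (- int n))) q k *
      qpoch (of_real (q powr (1 - c * real n)) / (s * t1)) q k *
      (- (of_real q ^ (n + 2)) / (t2 * t3)) ^ k =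
    (- 1 / (s * t1 * t2 * t3)) ^ k * of_real (q powr (real k ^ 2 + 2 * real k - c * real n * real k)) *
      (Q n / Q (n - k)) * R k"
  proof (induction k)
    case 0
    thus ?case using Qnz q by (simp add: R_def)
  next
    case (Suc k)
    \<comment> \<open>The two new factors are \<open>1 - 1 / p\<close> and
      \<open>1 - 1 / (u * (s * t1))\<close>. Reflecting both leaves the power
      \<open>q ^ (n + 2) / (p * u)\<close>, whose exponent 2k + 3 - cn is exactly the increment of
      k^2 + 2k - cnk from \<open>k\<close> to \<open>k + 1\<close>.\<close>
    define p where "p = complex_of_real q ^ (n - k)"
    define u where "u = complex_of_real (q powr (c * real n - 1 - real k))"
    have pnz: "p \<noteq> 0" and unz: "u \<noteq> 0" using q by (simp_all add: p_def u_def)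
    have 1: "of_real (q powi (- int n)) * of_real q ^ k = 1 / p"
    proof -
      have "complex_of_real q ^ n = p * of_real q ^ k"
        using Suc.prems by (simp add: p_def flip: power_add)
      thus ?thesis using q pnz by (simp add: power_int_minus field_simps)
    qed
    have 2: "complex_of_real (q powr (1 - c * real n)) / (s * t1) * of_real q ^ k = 1 / (u * (s * t1))"
    proof -
      have "q powr (1 - c * real n) * q ^ k = q powr (- (c * real n - 1 - real k))"
        using q by (simp add: powr_add[symmetric] powr_realpow[symmetric] algebra_simps)
      hence "q powr (1 - c * real n) * q ^ k = 1 / q powr (c * real n - 1 - real k)"
        by (simp only: powr_minus_divide)
      hence "complex_of_real (q powr (1 - c * real n)) * of_real q ^ k = 1 / u"
        unfolding u_def by (metis of_real_mult of_real_power of_real_divide of_real_1)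
      thus ?thesis by simp
    qed
    have 3: "complex_of_real q ^ (n + 2) / (p * u) = of_real (q powr (2 * real k + 3 - c * real n))"
    proof -
      have "q ^ (n + 2) / (q ^ (n - k) * q powr (c * real n - 1 - real k)) =
          q powr (real (n + 2) - (real (n - k) + (c * real n - 1 - real k)))"
        using q by (simp only: powr_diff powr_add powr_realpow)
      also have "real (n + 2) - (real (n - k) + (c * real n - 1 - real k)) = 2 * real k + 3 - c * real n"
        using Suc.prems by (simp add: of_nat_diff)
      finally show ?thesis
        unfolding p_def u_def by (metis of_real_mult of_real_power of_real_divide)
    qed
    have "(1 - 1 / p) * (1 - 1 / (u * (s * t1))) * (- (of_real q ^ (n + 2)) / (t2 * t3))
        = (- 1 / (s * t1 * t2 * t3)) * (of_real q ^ (n + 2) / (p * u)) * (1 - p) * (1 - u * (s * t1))"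
      using pnz unz nz by (simp add: divide_simps) (simp add: algebra_simps)
    hence factor: "(1 - of_real (q powi (- int n)) * of_real q ^ k) *
        (1 - of_real (q powr (1 - c * real n)) / (s * t1) * of_real q ^ k) *
        (- (of_real q ^ (n + 2)) / (t2 * t3)) =
        (- 1 / (s * t1 * t2 * t3)) * of_real (q powr (2 * real k + 3 - c * real n)) *
        (1 - p) * (1 - u * (s * t1))"
      unfolding 1 2 3 .
    have e: "q powr (real (Suc k) ^ 2 + 2 * real (Suc k) - c * real n * real (Suc k)) =
        q powr (real k ^ 2 + 2 * real k - c * real n * real k) * q powr (2 * real k + 3 - c * real n)"
      by (simp add: powr_add[symmetric] power2_eq_square algebra_simps)
    have Qk: "Q (n - k) = Q (n - Suc k) * (1 - p)"
    proof -
      have "n - k = Suc (n - Suc k)" using Suc.prems by simp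
      thus ?thesis by (simp add: Q_def p_def qpoch_Suc)
    qed
    hence Q: "Q n / Q (n - Suc k) = Q n / Q (n - k) * (1 - p)"
      using Qnz[of "n - k"] unfolding Qk by auto
    have RS: "R (Suc k) = R k * (1 - u * (s * t1))" by (simp add: R_def u_def)
    have "qpoch (of_real (q powi (- int n))) q (Suc k) *
        qpoch (of_real (q powr (1 - c * real n)) / (s * t1)) q (Suc k) *
        (- (of_real q ^ (n + 2)) / (t2 * t3)) ^ Suc k =
      (qpoch (of_real (q powi (- int n))) q k *
        qpoch (of_real (q powr (1 - c * real n)) / (s * t1)) q k *
        (- (of_real q ^ (n + 2)) / (t2 * t3)) ^ k) *
      ((1 - of_real (q powi (- int n)) * of_real q ^ k) *
        (1 - of_real (q powr (1 - c * real n)) / (s * t1) * of_real q ^ k) *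
        (- (of_real q ^ (n + 2)) / (t2 * t3)))"
      by (simp only: qpoch_Suc power_Suc mult_ac)
    also have "\<dots> = (- 1 / (s * t1 * t2 * t3)) ^ Suc k *
        of_real (q powr (real (Suc k) ^ 2 + 2 * real (Suc k) - c * real n * real (Suc k))) *
        (Q n / Q (n - Suc k)) * R (Suc k)"
      unfolding factor Q RS e of_real_mult
      using Suc.IH Suc.prems by (simp only: Suc_leD power_Suc mult_ac)
    finally show ?case .
  qed
  thus ?thesis by (simp only: R Q_def)
qed

text \<open>The common starting point of all cases. The factor
  \<open>qpoch (of_real q) q (n - k)\<close> stays outside \<open>V_coeff\<close> because its limit
  depends on the regime: its index is a fixed number if the sum is counted from the end
  \<open>k = n\<close>, but tends to infinity around \<open>k = c n / 2\<close> when
  \<open>c < 2\<close>.\<close>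

lemma V_x_seq_expansion:
  fixes q c :: real and s t1 t2 t3 :: complex
  assumes q: "0 < q" "q < 1" and nz: "t1 \<noteq> 0" "t2 \<noteq> 0" "t3 \<noteq> 0" "s \<noteq> 0"
  shows "V n (x_seq q c s n) t1 t2 t3 q = (t1 / of_real q) ^ n *
    (\<Sum>k\<le>n. (- 1 / (s * t1 * t2 * t3)) ^ k *
      of_real (q powr (real k ^ 2 + 2 * real k - c * real n * real k)) *
      (V_coeff q c s t1 t2 t3 n k / qpoch (of_real q) q (n - k)))"
proof -
  define z where "z = z_seq q c s n"
  have z: "z \<noteq> 0" using q nz by (simp add: z_def z_seq_def)
  have V: "V n (x_seq q c s n) t1 t2 t3 q = V_param n z t1 t2 t3 q"
    unfolding x_seq_eq[OF nz(4)] z_def[symmetric] by (rule V_eq_V_param[OF z])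
  have a2: "- of_real q / (t1 * z) = - of_real (q powr (c * real n + 1)) * s / t1"
    using q nz by (simp add: z_def z_seq_def powr_minus powr_add of_real_inverse field_simps)
  have a3: "of_real q * z / t1 = of_real (q powr (1 - c * real n)) / (s * t1)"
  proof -
    have "q powr (1 - c * real n) = q * q powr (- c * real n)"
      using q powr_add[of q 1 "- c * real n"] by simp
    thus ?thesis using nz by (simp add: z_def z_seq_def)
  qed
  define b1 where "b1 = qpoch (- (of_real q ^ 2) / (t1 * t3)) q"
  define b2 where "b2 = qpoch (- (of_real q ^ 2) / (t1 * t2)) q"
  define b3 where "b3 = qpoch (- (of_real q ^ 2) / (t2 * t3)) q"
  define Q where "Q = qpoch (of_real q) q"
  define A where "A k = qpoch (of_real (q powi (- int n))) q k" for k
  define B where "B = qpoch (- of_real (q powr (c * real n + 1)) * s / t1) q"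
  define D where "D = qpoch (of_real (q powr (1 - c * real n)) / (s * t1)) q"
  define y where "y = - (of_real q ^ (n + 2)) / (t2 * t3)"
  \<comment> \<open>The factor with index \<open>j = n\<close> is zero, which terminates the
    series.\<close>
  have A0: "A k = 0" if "k > n" for k
  proof -
    have "1 - complex_of_real (q powi (- int n)) * of_real q ^ n = 0"
      using q by (simp add: power_int_minus)
    thus ?thesis using that unfolding A_def qpoch_def by (intro prod_zero) auto
  qed
  have "phi32 (of_real (q powi (- int n))) (- of_real (q powr (c * real n + 1)) * s / t1)
      (of_real (q powr (1 - c * real n)) / (s * t1)) (- (of_real q ^ 2) / (t1 * t3))
      (- (of_real q ^ 2) / (t1 * t2)) q (- (of_real q ^ (n + 2)) / (t2 * t3))
      = (\<Sum>k. A k * B k * D k / (Q k * b1 k * b2 k) * y ^ k)"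
    by (simp only: phi32_def A_def B_def D_def Q_def b1_def b2_def y_def)
  also have "\<dots> = (\<Sum>k\<le>n. A k * B k * D k / (Q k * b1 k * b2 k) * y ^ k)"
    by (rule suminf_finite) (auto simp: A0)
  also have "\<dots> = (\<Sum>k\<le>n. (A k * D k * y ^ k) * (B k / (Q k * b1 k * b2 k)))"
    by (simp add: mult_ac)
  finally have "V n (x_seq q c s n) t1 t2 t3 q = (t1 / of_real q) ^ n *
      (\<Sum>k\<le>n. b1 n / b3 n * ((A k * D k * y ^ k) * (B k / (Q k * b1 k * b2 k))))"
    unfolding V V_param_def a2 a3
    by (simp only: b1_def b3_def sum_distrib_left mult.assoc)
  also have "(\<Sum>k\<le>n. b1 n / b3 n * ((A k * D k * y ^ k) * (B k / (Q k * b1 k * b2 k)))) =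
     (\<Sum>k\<le>n. (- 1 / (s * t1 * t2 * t3)) ^ k *
      of_real (q powr (real k ^ 2 + 2 * real k - c * real n * real k)) *
      (V_coeff q c s t1 t2 t3 n k / qpoch (of_real q) q (n - k)))"
  proof (rule sum.cong[OF refl])
    fix k assume "k \<in> {..n}"
    hence *: "A k * D k * y ^ k = (- 1 / (s * t1 * t2 * t3)) ^ k *
        of_real (q powr (real k ^ 2 + 2 * real k - c * real n * real k)) *
        (Q n / Q (n - k)) * qpoch (of_real (q powr (c * real n - real k)) * (s * t1)) q k"
      unfolding A_def D_def y_def Q_def using qpoch_reflect[OF q nz] by simp
    show "b1 n / b3 n * ((A k * D k * y ^ k) * (B k / (Q k * b1 k * b2 k))) =
      (- 1 / (s * t1 * t2 * t3)) ^ k *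
      of_real (q powr (real k ^ 2 + 2 * real k - c * real n * real k)) *
      (V_coeff q c s t1 t2 t3 n k / qpoch (of_real q) q (n - k))"
      unfolding * V_coeff_def b1_def[symmetric] b2_def[symmetric] b3_def[symmetric] Q_def[symmetric]
        B_def[symmetric]
      by (simp add: mult_ac)
  qed
  finally show ?thesis .
qed

text \<open>Here \<open>1 \<le> c\<close> enters: it gives \<open>k \<le> c * n\<close> for all
  \<open>k \<le> n\<close>, so the arguments of the two factors containing \<open>s\<close> stay
  below their values without the power of \<open>q\<close>. The remaining factors are bounded, with
  bounded inverses.\<close>

lemma V_coeff_bounded:
  fixes q c :: real and s t1 t2 t3 :: complex
  assumes q: "0 < q" "q < 1" and c: "1 \<le> c"
    and nz: "\<And>k. qpoch (- (of_real q ^ 2) / (t1 * t2)) q k \<noteq> 0"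
      "\<And>k. qpoch (- (of_real q ^ 2) / (t1 * t3)) q k \<noteq> 0"
      "\<And>k. qpoch (- (of_real q ^ 2) / (t2 * t3)) q k \<noteq> 0"
  shows "\<exists>K>0. \<forall>n k. k \<le> n \<longrightarrow> norm (V_coeff q c s t1 t2 t3 n k / qpoch (of_real q) q (n - k)) \<le> K"
proof -
  define b1 where "b1 = qpoch (- (of_real q ^ 2) / (t1 * t3)) q"
  define b2 where "b2 = qpoch (- (of_real q ^ 2) / (t1 * t2)) q"
  define b3 where "b3 = qpoch (- (of_real q ^ 2) / (t2 * t3)) q"
  define Q where "Q = qpoch (of_real q) q"
  obtain K1 where K1: "K1 > 0" "\<And>n. norm (inverse (b1 n)) \<le> K1"
    using bounded_inverse_qpoch[OF q nz(2)] unfolding b1_def by blast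
  obtain K2 where K2: "K2 > 0" "\<And>n. norm (inverse (b2 n)) \<le> K2"
    using bounded_inverse_qpoch[OF q nz(1)] unfolding b2_def by blast
  obtain K3 where K3: "K3 > 0" "\<And>n. norm (inverse (b3 n)) \<le> K3"
    using bounded_inverse_qpoch[OF q nz(3)] unfolding b3_def by blast
  obtain K4 where K4: "K4 > 0" "\<And>n. norm (inverse (Q n)) \<le> K4"
    using bounded_inverse_qpoch[OF q qpoch_self_nonzero[OF q]] unfolding Q_def by blast
  define E where "E a = exp (norm a / (1 - q))" for a :: complex
  have E: "norm (qpoch a q k) \<le> E b" if "norm a \<le> norm b" for a b k
    unfolding E_def using norm_qpoch_le[OF q that] .
  have E_pos: "E a > 0" for a by (simp add: E_def)
  define M where "M = E (of_real q) * E (- (of_real q ^ 2) / (t1 * t3)) * E (s * t1) * E (s / t1)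
      * (K4 * K1 * K2 * K3 * K4)"
  show ?thesis
  proof (intro exI conjI allI impI)
    show "M > 0" using K1(1) K2(1) K3(1) K4(1) by (simp add: M_def E_pos)
    fix n k :: nat assume k: "k \<le> n"
    define X where "X = qpoch (of_real (q powr (c * real n - real k)) * (s * t1)) q k"
    define Y where "Y = qpoch (- of_real (q powr (c * real n + 1)) * s / t1) q k"
    have ck: "real k \<le> c * real n"
    proof -
      have "1 * real n \<le> c * real n" using c by (intro mult_right_mono) auto
      thus ?thesis using k by simp
    qed
    have X: "norm X \<le> E (s * t1)"
      unfolding X_def
    proof (rule E)
      have "q powr (c * real n - real k) \<le> 1" using q ck by (simp add: powr_le1)
      thus "norm (of_real (q powr (c * real n - real k)) * (s * t1)) \<le> norm (s * t1)"
        using mult_right_mono[of "q powr (c * real n - real k)" 1 "norm (s * t1)"]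
        by (simp only: norm_mult norm_of_real abs_of_nonneg powr_ge_zero) simp
    qed
    have Y: "norm Y \<le> E (s / t1)"
      unfolding Y_def
    proof (rule E)
      have "q powr (c * real n + 1) \<le> 1" using q c by (simp add: powr_le1)
      thus "norm (- of_real (q powr (c * real n + 1)) * s / t1) \<le> norm (s / t1)"
        using mult_right_mono[of "q powr (c * real n + 1)" 1 "norm (s / t1)"]
        by (simp add: norm_mult norm_divide)
    qed
    have "norm (V_coeff q c s t1 t2 t3 n k / Q (n - k)) = norm (Q n) * norm (b1 n) * norm X * norm Y *
        (norm (inverse (Q k)) * norm (inverse (b1 k)) * norm (inverse (b2 k)) * norm (inverse (b3 n)) *
          norm (inverse (Q (n - k))))"
      unfolding V_coeff_def b1_def[symmetric] b2_def[symmetric] b3_def[symmetric] Q_def[symmetric]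
        X_def[symmetric] Y_def[symmetric]
      by (simp add: norm_mult norm_divide norm_inverse divide_inverse mult_ac)
    also have "\<dots> \<le> M"
      unfolding M_def
      by (intro mult_mono K1(2) K2(2) K3(2) K4(2) X Y)
        (use K1(1) K2(1) K3(1) K4(1) in \<open>auto simp: Q_def b1_def E less_imp_le[OF E_pos]\<close>)
    finally show "norm (V_coeff q c s t1 t2 t3 n k / qpoch (of_real q) q (n - k)) \<le> M"
      by (simp only: Q_def)
  qed
qed

lemma tendsto_powr_0:
  fixes q :: real
  assumes "0 < q" "q < 1" "filterlim f at_top F"
  shows "((\<lambda>n. q powr f n) \<longlongrightarrow> 0) F"
proof -
  have "filterlim (\<lambda>n. ln q * f n) at_bot F"
    using assms by (intro filterlim_tendsto_neg_mult_at_bot[OF tendsto_const]) auto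
  hence "((\<lambda>n. exp (ln q * f n)) \<longlongrightarrow> 0) F"
    by (rule filterlim_compose[OF exp_at_bot])
  thus ?thesis using assms by (simp add: powr_def mult.commute)
qed

text \<open>The arguments of the two factors containing \<open>s\<close> tend to 0, so these factors
  tend to 1 although their length grows. The other finite products tend to infinite ones, and those
  for \<open>q\<close> and for \<open>t1 * t3\<close> cancel. The index \<open>k n\<close> is left
  free to serve both \<open>n - i\<close> and \<open>m n + j\<close>.\<close>

lemma V_coeff_tendsto:
  fixes q c :: real and s t1 t2 t3 :: complex
  assumes q: "0 < q" "q < 1"
    and nz: "\<And>k. qpoch (- (of_real q ^ 2) / (t1 * t2)) q k \<noteq> 0"
      "\<And>k. qpoch (- (of_real q ^ 2) / (t1 * t3)) q k \<noteq> 0"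
      "\<And>k. qpoch (- (of_real q ^ 2) / (t2 * t3)) q k \<noteq> 0"
    and F: "F \<le> sequentially" and k: "filterlim k at_top F"
    and ck: "filterlim (\<lambda>n. c * real n - real (k n)) at_top F"
  shows "((\<lambda>n. V_coeff q c s t1 t2 t3 n (k n)) \<longlongrightarrow>
    1 / (qpoch_inf (- (of_real q ^ 2) / (t1 * t2)) q * qpoch_inf (- (of_real q ^ 2) / (t2 * t3)) q)) F"
proof -
  define b1 where "b1 = - (of_real q ^ 2) / (t1 * t3)"
  define b2 where "b2 = - (of_real q ^ 2) / (t1 * t2)"
  define b3 where "b3 = - (of_real q ^ 2) / (t2 * t3)"
  have lim: "((\<lambda>n. qpoch a q n) \<longlongrightarrow> qpoch_inf a q) F"
    and limk: "((\<lambda>n. qpoch a q (k n)) \<longlongrightarrow> qpoch_inf a q) F" for a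
    using qpoch_LIMSEQ[OF q] F k by (auto intro: tendsto_mono filterlim_compose)
  have inf_nz: "qpoch_inf (of_real q) q \<noteq> 0" "qpoch_inf b1 q \<noteq> 0" "qpoch_inf b2 q \<noteq> 0" "qpoch_inf b3 q \<noteq> 0"
    unfolding b1_def b2_def b3_def
    by (rule qpoch_inf_nonzero[OF q], rule nz qpoch_self_nonzero[OF q])+
  have X: "((\<lambda>n. qpoch (of_real (q powr (c * real n - real (k n))) * (s * t1)) q (k n)) \<longlongrightarrow> 1) F"
  proof (rule tendsto_qpoch_1[OF q])
    have "((\<lambda>n. of_real (q powr (c * real n - real (k n))) * (s * t1)) \<longlongrightarrow> of_real 0 * (s * t1)) F"
      by (intro tendsto_intros tendsto_powr_0[OF q] ck)
    thus "((\<lambda>n. of_real (q powr (c * real n - real (k n))) * (s * t1)) \<longlongrightarrow> 0) F" by simp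
  qed
  have Y: "((\<lambda>n. qpoch (- of_real (q powr (c * real n + 1)) * s / t1) q (k n)) \<longlongrightarrow> 1) F"
  proof (rule tendsto_qpoch_1[OF q])
    have "filterlim (\<lambda>n. c * real n + 1) at_top F"
      by (rule filterlim_at_top_mono[OF ck]) (auto intro!: always_eventually)
    hence "((\<lambda>n. - of_real (q powr (c * real n + 1)) * (s / t1)) \<longlongrightarrow> - of_real 0 * (s / t1)) F"
      by (intro tendsto_intros tendsto_powr_0[OF q])
    thus "((\<lambda>n. - of_real (q powr (c * real n + 1)) * s / t1) \<longlongrightarrow> 0) F" by simp
  qed
  have "((\<lambda>n. V_coeff q c s t1 t2 t3 n (k n)) \<longlongrightarrow>
     qpoch_inf (of_real q) q / qpoch_inf (of_real q) q * (qpoch_inf b1 q / qpoch_inf b1 q) * 1 * 1 /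
     (qpoch_inf b2 q * qpoch_inf b3 q)) F"
    unfolding V_coeff_def b1_def[symmetric] b2_def[symmetric] b3_def[symmetric]
    using inf_nz by (intro tendsto_intros lim limk X Y) auto
  thus ?thesis using inf_nz by (simp add: b2_def b3_def)
qed

section \<open>The regime c >= 2: one-sided sums\<close>

lemma V_upper_regime_tendsto:
  fixes q c :: real and s t1 t2 t3 :: complex
  assumes q: "0 < q" "q < 1" and nz: "t1 \<noteq> 0" "t2 \<noteq> 0" "t3 \<noteq> 0" "s \<noteq> 0"
    and b_nz: "\<And>k. qpoch (- (of_real q ^ 2) / (t1 * t2)) q k \<noteq> 0"
      "\<And>k. qpoch (- (of_real q ^ 2) / (t1 * t3)) q k \<noteq> 0"
      "\<And>k. qpoch (- (of_real q ^ 2) / (t2 * t3)) q k \<noteq> 0"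
    and c: "2 \<le> c"
  shows "(\<lambda>n. (- (s * t2 * t3)) ^ n * of_real (q powr ((c - 1) * real n ^ 2 - real n)) *
           V n (x_seq q c s n) t1 t2 t3 q) \<longlonglongrightarrow>
    1 / (qpoch_inf (- (of_real q ^ 2) / (t1 * t2)) q * qpoch_inf (- (of_real q ^ 2) / (t2 * t3)) q) *
    (\<Sum>i. (if c = 2 \<or> i = 0 then 1 else 0) * ((-1) ^ i * of_real (q powr (real i ^ 2 - 2 * real i)) *
      (s * t1 * t2 * t3) ^ i / qpoch (of_real q) q i))"
proof -
  define S where "S = s * t1 * t2 * t3"
  have S: "S \<noteq> 0" using nz by (simp add: S_def)
  define Q where "Q = qpoch (of_real q) q"
  define W where "W = V_coeff q c s t1 t2 t3"
  define C where "C = qpoch_inf (- (of_real q ^ 2) / (t1 * t2)) q * qpoch_inf (- (of_real q ^ 2) / (t2 * t3)) q"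
  have C: "C \<noteq> 0"
    unfolding C_def by (intro no_zero_divisors qpoch_inf_nonzero[OF q b_nz(1)] qpoch_inf_nonzero[OF q b_nz(3)])
  have "1 \<le> c" using c by simp
  obtain K where K: "K > 0" "\<And>n k. k \<le> n \<Longrightarrow> norm (W n k / Q (n - k)) \<le> K"
    using V_coeff_bounded[OF q \<open>1 \<le> c\<close> b_nz] unfolding W_def Q_def by blast
  \<comment> \<open>With k = n - i, the exponent (c-1)n^2 - n + k^2 + 2k - cnk becomes i^2 - 2i +
    (c-2)ni + n. The last \<open>n\<close> cancels against \<open>(t1 / q) ^ n\<close>,
    \<open>T\<close> takes the part free of \<open>n\<close>, and \<open>\<epsilon>\<close> the
    rest. The latter is 1 for c = 2 and kills every i > 0 for c > 2, whence the indicator in the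
    limit.\<close>
  define T where "T i = (- S) ^ i * of_real (q powr (real i ^ 2 - 2 * real i))" for i :: nat
  define \<epsilon> where "\<epsilon> i n = q powr ((c - 2) * real n * real i)" for i n :: nat
  \<comment> \<open>The factor \<open>C\<close> offsets the limit \<open>1 / C\<close> of
    \<open>W\<close>. The guard is essential, since \<open>n - i\<close> would be 0 for all
    \<open>i > n\<close>.\<close>
  define a where "a i n = (if i \<le> n then C * T i * of_real (\<epsilon> i n) * (W n (n - i) / Q i) else 0)" for i n
  have "((\<lambda>n. \<Sum>i. a i n) \<longlonglongrightarrow> (\<Sum>i. T i * (if c = 2 \<or> i = 0 then 1 else 0) / Q i))"
  proof (rule tannerys_theorem[THEN conjunct2, THEN conjunct2])
    define M where "M i = q powr (real i ^ 2 + (log q (norm S) - 2) * real i) * (norm C * K)" for i :: nat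
    show "summable M"
      unfolding M_def by (intro summable_mult2 summable_powr_quadratic[OF q])
    have T: "norm (T i) = q powr (real i ^ 2 + (log q (norm S) - 2) * real i)" for i
    proof -
      have "norm S ^ i = q powr (log q (norm S) * real i)"
        using q S by (simp add: powr_realpow flip: powr_powr)
      thus ?thesis by (simp add: T_def norm_mult norm_power powr_add[symmetric] algebra_simps)
    qed
    have "norm (a i n) \<le> M i" for i n
    proof (cases "i \<le> n")
      case True
      have "\<epsilon> i n \<le> 1" using q c by (simp add: \<epsilon>_def powr_le1)
      moreover have "norm (W n (n - i) / Q i) \<le> K" using K(2)[of "n - i" n] True by simp
      ultimately have "norm (T i) * norm C * (\<epsilon> i n * norm (W n (n - i) / Q i)) \<le> norm (T i) * norm C * (1 * K)"
        by (intro mult_left_mono mult_mono) (auto simp: \<epsilon>_def)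
      moreover have "norm (a i n) = norm (T i) * norm C * (\<epsilon> i n * norm (W n (n - i) / Q i))"
        using True by (simp add: a_def norm_mult norm_divide \<epsilon>_def)
      ultimately show ?thesis by (simp add: M_def T)
    qed (use K(1) in \<open>simp add: a_def M_def\<close>)
    thus "\<forall>\<^sub>F (i, n) in at_top \<times>\<^sub>F sequentially. norm (a i n) \<le> M i"
      by (intro always_eventually) auto
    show "(\<lambda>n. a i n) \<longlonglongrightarrow> T i * (if c = 2 \<or> i = 0 then 1 else 0) / Q i" for i
    proof (rule Lim_transform_eventually)
      have "filterlim (\<lambda>n. n - i) at_top sequentially"
        unfolding filterlim_at_top
      proof
        fix Z show "\<forall>\<^sub>F n in sequentially. Z \<le> n - i"
          using eventually_ge_at_top[of "Z + i"] by eventually_elim simp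
      qed
      moreover have "filterlim (\<lambda>n. c * real n - real (n - i)) at_top sequentially"
      proof (rule filterlim_at_top_mono[OF filterlim_real_sequentially])
        have "2 * real n \<le> c * real n" for n using c by (intro mult_right_mono) auto
        thus "\<forall>\<^sub>F n in sequentially. real n \<le> c * real n - real (n - i)"
          by (intro always_eventually allI) (smt (verit) of_nat_mono diff_le_self)
      qed
      ultimately have "(\<lambda>n. W n (n - i)) \<longlonglongrightarrow> 1 / C"
        unfolding W_def C_def by (intro V_coeff_tendsto[OF q b_nz]) auto
      moreover have "(\<lambda>n. \<epsilon> i n) \<longlonglongrightarrow> (if c = 2 \<or> i = 0 then 1 else 0)"
      proof (cases "c = 2 \<or> i = 0")
        case True
        thus ?thesis using q by (auto simp: \<epsilon>_def)
      next
        case False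
        have "filterlim (\<lambda>n. (c - 2) * real i * real n) at_top sequentially"
          using False c by (intro filterlim_tendsto_pos_mult_at_top[OF tendsto_const _ filterlim_real_sequentially]) auto
        hence "filterlim (\<lambda>n. (c - 2) * real n * real i) at_top sequentially"
          by (simp add: mult_ac)
        thus ?thesis unfolding \<epsilon>_def using False tendsto_powr_0[OF q] by auto
      qed
      ultimately have "(\<lambda>n. C * T i * of_real (\<epsilon> i n) * (W n (n - i) / Q i)) \<longlonglongrightarrow>
          C * T i * of_real (if c = 2 \<or> i = 0 then 1 else 0) * (1 / C / Q i)"
        using qpoch_self_nonzero[OF q] by (intro tendsto_intros) (auto simp: Q_def)
      thus "(\<lambda>n. C * T i * of_real (\<epsilon> i n) * (W n (n - i) / Q i)) \<longlonglongrightarrow>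
          T i * (if c = 2 \<or> i = 0 then 1 else 0) / Q i"
        using C by (auto split: if_splits)
      show "\<forall>\<^sub>F n in sequentially. C * T i * of_real (\<epsilon> i n) * (W n (n - i) / Q i) = a i n"
        using eventually_ge_at_top[of i] by eventually_elim (simp add: a_def)
    qed
  qed auto
  hence "(\<lambda>n. 1 / C * (\<Sum>i. a i n)) \<longlonglongrightarrow> 1 / C * (\<Sum>i. T i * (if c = 2 \<or> i = 0 then 1 else 0) / Q i)"
    by (intro tendsto_intros)
  moreover have "1 / C * (\<Sum>i. a i n) = (- (s * t2 * t3)) ^ n *
      of_real (q powr ((c - 1) * real n ^ 2 - real n)) * V n (x_seq q c s n) t1 t2 t3 q" for n
  proof -
    have "(\<Sum>i. a i n) = (\<Sum>i\<le>n. a i n)"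
      by (rule suminf_finite) (auto simp: a_def)
    also have "1 / C * \<dots> = (\<Sum>i\<le>n. T i * of_real (\<epsilon> i n) * (W n (n - i) / Q i))"
      using C by (simp add: a_def sum_distrib_left mult_ac)
    also have "\<dots> = (\<Sum>k\<le>n. T (n - k) * of_real (\<epsilon> (n - k) n) * (W n (n - (n - k)) / Q (n - k)))"
      by (rule sum.reindex_bij_witness[of _ "\<lambda>k. n - k" "\<lambda>k. n - k"]) auto
    also have "\<dots> = (\<Sum>k\<le>n. (- (s * t2 * t3)) ^ n * of_real (q powr ((c - 1) * real n ^ 2 - real n)) *
        ((t1 / of_real q) ^ n * ((- 1 / S) ^ k * of_real (q powr (real k ^ 2 + 2 * real k - c * real n * real k)) *
        (W n k / Q (n - k)))))"
    proof (rule sum.cong[OF refl])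
      fix k assume "k \<in> {..n}"
      define i where "i = n - k"
      have k: "n - i = k" "real k = real n - real i" and n: "n = i + k"
        using \<open>k \<in> {..n}\<close> by (auto simp: i_def of_nat_diff)
      have "q powr (real i ^ 2 - 2 * real i) * q powr ((c - 2) * real n * real i) * q ^ n =
          q powr ((c - 1) * real n ^ 2 - real n) * q powr (real k ^ 2 + 2 * real k - c * real n * real k)"
        using q unfolding k(2)
        by (simp add: powr_realpow[symmetric] powr_add[symmetric]) (simp add: power2_eq_square algebra_simps)
      hence "q powr (real i ^ 2 - 2 * real i) * q powr ((c - 2) * real n * real i) =
          q powr ((c - 1) * real n ^ 2 - real n) * q powr (real k ^ 2 + 2 * real k - c * real n * real k) / q ^ n"
        using q by (simp add: field_simps)
      hence powr: "complex_of_real (q powr (real i ^ 2 - 2 * real i)) * of_real (q powr ((c - 2) * real n * real i)) =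
          of_real (q powr ((c - 1) * real n ^ 2 - real n)) *
          of_real (q powr (real k ^ 2 + 2 * real k - c * real n * real k)) / of_real q ^ n"
        unfolding of_real_mult[symmetric] of_real_power[symmetric] of_real_divide[symmetric]
        by (rule arg_cong)
      \<comment> \<open>The prefactor and \<open>t1 ^ n\<close> combine to \<open>(- S) ^ n\<close>,
        of which \<open>(- 1 / S) ^ k\<close> leaves the power \<open>i = n - k\<close>.\<close>
      have "(- (s * t2 * t3)) ^ n * t1 ^ n = (- S) ^ n"
        by (simp add: S_def mult_ac flip: power_mult_distrib)
      also have "\<dots> = (- S) ^ i * (- S) ^ k" by (simp add: n power_add)
      finally have "(- (s * t2 * t3)) ^ n * t1 ^ n * (- 1 / S) ^ k = (- S) ^ i * ((- S) ^ k * (- 1 / S) ^ k)"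
        by (simp only: mult.assoc)
      also have "(- S) ^ k * (- 1 / S) ^ k = 1"
        using S by (simp flip: power_mult_distrib)
      finally have "(- S) ^ i = (- (s * t2 * t3)) ^ n * t1 ^ n * (- 1 / S) ^ k" by simp
      thus "T (n - k) * of_real (\<epsilon> (n - k) n) * (W n (n - (n - k)) / Q (n - k)) =
        (- (s * t2 * t3)) ^ n * of_real (q powr ((c - 1) * real n ^ 2 - real n)) *
        ((t1 / of_real q) ^ n * ((- 1 / S) ^ k * of_real (q powr (real k ^ 2 + 2 * real k - c * real n * real k)) *
        (W n k / Q (n - k))))"
        unfolding T_def \<epsilon>_def i_def[symmetric] k(1) using powr
        by (simp add: power_divide mult_ac)
    qed
    also have "\<dots> = (- (s * t2 * t3)) ^ n * of_real (q powr ((c - 1) * real n ^ 2 - real n)) *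
        V n (x_seq q c s n) t1 t2 t3 q"
      unfolding V_x_seq_expansion[OF q nz] sum_distrib_left S_def Q_def W_def ..
    finally show ?thesis .
  qed
  moreover have "T i * (if c = 2 \<or> i = 0 then 1 else 0) / Q i =
    (if c = 2 \<or> i = 0 then 1 else 0) * ((-1) ^ i * of_real (q powr (real i ^ 2 - 2 * real i)) * S ^ i / Q i)" for i
    by (simp add: T_def power_minus[of S] mult_ac)
  ultimately show ?thesis by (simp only: C_def Q_def S_def)
qed

section \<open>The regime 1 <= c < 2: theta series\<close>

lemma theta_term_scaled:
  fixes q a :: real and y :: complex
  assumes "0 < q" "y \<noteq> 0"
  shows "(of_real (q powr a) * y) powi j * of_real (q powr (real_of_int j)\<^sup>2) =
    y powi j * of_real (q powr ((real_of_int j)\<^sup>2 + a * real_of_int j))"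
proof -
  have "(q powr a) powi j = q powr (a * real_of_int j)"
    using assms by (simp add: powr_real_of_int' flip: powr_powr)
  thus ?thesis
    by (simp add: power_int_mult_distrib powr_add mult_ac flip: of_real_power_int)
qed

text \<open>Fixing \<open>r\<close> means restricting the filter to those \<open>n\<close> for which
  c n / 2 has fractional part \<open>r\<close>. If there are only finitely many, the filter is
  \<open>bot\<close> and the limit holds trivially.\<close>

lemma V_lower_regime_tendsto:
  fixes q c r :: real and s t1 t2 t3 :: complex
  assumes q: "0 < q" "q < 1" and nz: "t1 \<noteq> 0" "t2 \<noteq> 0" "t3 \<noteq> 0" "s \<noteq> 0"
    and b_nz: "\<And>k. qpoch (- (of_real q ^ 2) / (t1 * t2)) q k \<noteq> 0"
      "\<And>k. qpoch (- (of_real q ^ 2) / (t1 * t3)) q k \<noteq> 0"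
      "\<And>k. qpoch (- (of_real q ^ 2) / (t2 * t3)) q k \<noteq> 0"
    and c: "1 \<le> c" "c < 2"
  shows "((\<lambda>n. let m = nat \<lfloor>c * real n / 2\<rfloor> in
                 (- (s * t2 * t3)) ^ m *
                 of_real (q powr (real n + c ^ 2 * real n ^ 2 / 4 - 2 * real m)) *
                 t1 powi (int m - int n) *
                 V n (x_seq q c s n) t1 t2 t3 q)
            \<longlongrightarrow> of_real (q powr (r ^ 2)) *
                (qpoch_inf (of_real (q ^ 2)) (q ^ 2) *
                 qpoch_inf (of_real (q powr (3 - 2 * r)) / (s * t1 * t2 * t3)) (q ^ 2) *
                 qpoch_inf (of_real (q powr (- (1 - 2 * r))) * (s * t1 * t2 * t3)) (q ^ 2)) /
                (qpoch_inf (of_real q) q *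
                 qpoch_inf (- (of_real q ^ 2) / (t1 * t2)) q *
                 qpoch_inf (- (of_real q ^ 2) / (t2 * t3)) q))
          (inf sequentially (principal {n. frac (c * real n / 2) = r}))"
  (is "(?f \<longlongrightarrow> _ * ?J / ?C) ?F")
proof (cases "?F = bot")
  case True
  thus ?thesis by simp
next
  case False
  define F where "F = ?F"
  have F: "F \<noteq> bot" "F \<le> sequentially" and evr: "\<forall>\<^sub>F n in F. frac (c * real n / 2) = r"
    using False by (auto simp: F_def eventually_inf_principal)
  define m where "m n = nat \<lfloor>c * real n / 2\<rfloor>" for n :: nat
  have m_le: "real (m n) \<le> c * real n / 2" for n
    unfolding m_def by (rule of_nat_floor) (use c in simp)
  define S where "S = s * t1 * t2 * t3"
  have S: "S \<noteq> 0" using nz by (simp add: S_def)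
  define Q where "Q = qpoch (of_real q) q"
  define Qinf where "Qinf = qpoch_inf (of_real q) q"
  define W where "W = V_coeff q c s t1 t2 t3"
  define B where "B = qpoch_inf (- (of_real q ^ 2) / (t1 * t2)) q * qpoch_inf (- (of_real q ^ 2) / (t2 * t3)) q"
  have B: "B \<noteq> 0"
    unfolding B_def by (intro no_zero_divisors qpoch_inf_nonzero[OF q b_nz(1)] qpoch_inf_nonzero[OF q b_nz(3)])
  have Qinf: "Qinf \<noteq> 0"
    unfolding Qinf_def by (rule qpoch_inf_nonzero[OF q qpoch_self_nonzero[OF q]])
  obtain K where K: "K > 0" "\<And>n k. k \<le> n \<Longrightarrow> norm (W n k / Q (n - k)) \<le> K"
    using V_coeff_bounded[OF q c(1) b_nz] unfolding W_def Q_def by blast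
  \<comment> \<open>Put cn = 2(m + r) and k = m + j. Then k^2 + 2k - cnk + c^2 n^2 / 4 - 2m = j^2 +
    (2 - 2r)j + r^2. The linear term is absorbed into the base \<open>w\<close> of the theta series,
    and r^2 becomes the prefactor of the limit.\<close>
  define w where "w = of_real (q powr (2 - 2 * r)) * (- 1 / S)"
  have w: "w \<noteq> 0" using S q by (simp add: w_def)
  define \<theta> where "\<theta> j = w powi j * of_real (q powr (real_of_int j)\<^sup>2)" for j
  \<comment> \<open>The limits of \<open>W\<close> and of \<open>1 / Q (n - k)\<close> are
    \<open>1 / B\<close> and \<open>1 / Qinf\<close>; the constant in front cancels both.\<close>
  define g where "g n k = Qinf * B * \<theta> (int k - int (m n)) * (W n k / Q (n - k))" for n k
  have m_top: "filterlim m at_top F"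
  proof (rule filterlim_mono[OF _ order.refl F(2)], unfold filterlim_at_top, intro allI)
    fix Z
    show "\<forall>\<^sub>F n in sequentially. Z \<le> m n"
      using eventually_ge_at_top[of "2 * Z"]
    proof eventually_elim
      case (elim n)
      have "1 * real n \<le> c * real n" using c by (intro mult_right_mono) auto
      hence "real Z \<le> c * real n / 2" using elim by linarith
      thus ?case unfolding m_def by (rule le_nat_floor)
    qed
  qed
  \<comment> \<open>This is where \<open>c < 2\<close> is used: n - m is at least (1 - c/2)n, so the
    centre moves away from the end \<open>k = n\<close>.\<close>
  have nm_top: "filterlim (\<lambda>n. n - m n) at_top F"
  proof (rule filterlim_mono[OF _ order.refl F(2)], unfold filterlim_at_top, intro allI)
    fix Z
    show "\<forall>\<^sub>F n in sequentially. Z \<le> n - m n"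
      using eventually_ge_at_top[of "nat \<lceil>real Z / (1 - c / 2)\<rceil>"]
    proof eventually_elim
      case (elim n)
      hence "real Z / (1 - c / 2) \<le> real n" by linarith
      hence "real Z \<le> real n - c * real n / 2" using c by (simp add: field_simps)
      hence "real Z + real (m n) \<le> real n" using m_le[of n] by linarith
      thus ?case by linarith
    qed
  qed
  have lim: "((\<lambda>n. \<Sum>k\<le>n. g n k) \<longlongrightarrow> (\<Sum>i. \<theta> (int i) + \<theta> (- int (Suc i)))) F"
  proof -
    define h where "h j = q powr ((real_of_int j)\<^sup>2 + log q (norm w) * real_of_int j) * (norm (Qinf * B) * K)" for j
    show ?thesis
    proof (rule bilateral_tannery[OF F(1) m_top nm_top, where h = h])
      show "((\<lambda>n. g n (nat (int (m n) + j))) \<longlongrightarrow> \<theta> j) F" for j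
      proof (rule Lim_transform_eventually)
        have k_top: "filterlim (\<lambda>n. nat (int (m n) + j)) at_top F"
          by (rule filterlim_nat_int_add[OF m_top])
        have "filterlim (\<lambda>n. c * real n - real (nat (int (m n) + j))) at_top F"
        proof (rule filterlim_mono[OF _ order.refl F(2)], unfold filterlim_at_top, intro allI)
          fix Z
          show "\<forall>\<^sub>F n in sequentially. Z \<le> c * real n - real (nat (int (m n) + j))"
            using eventually_ge_at_top[of "nat \<lceil>2 * (Z + \<bar>real_of_int j\<bar>)\<rceil>"]
          proof eventually_elim
            case (elim n)
            have "1 * real n \<le> c * real n" using c by (intro mult_right_mono) auto
            moreover have "2 * (Z + \<bar>real_of_int j\<bar>) \<le> real n" using elim by linarith
            ultimately have "Z \<le> c * real n - (real (m n) + \<bar>real_of_int j\<bar>)"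
              using m_le[of n] by argo
            also have "\<dots> \<le> c * real n - real (nat (int (m n) + j))"
              by (intro diff_left_mono) linarith
            finally show ?case .
          qed
        qed
        hence W: "((\<lambda>n. W n (nat (int (m n) + j))) \<longlongrightarrow> 1 / B) F"
          unfolding W_def B_def by (intro V_coeff_tendsto[OF q b_nz F(2)] k_top)
        have "((\<lambda>n. Q (nat (int (n - m n) + - j))) \<longlongrightarrow> Qinf) F"
          unfolding Q_def Qinf_def
          by (rule filterlim_compose[OF qpoch_LIMSEQ[OF q] filterlim_nat_int_add[OF nm_top]])
        hence "((\<lambda>n. Qinf * B * \<theta> j * (W n (nat (int (m n) + j)) / Q (nat (int (n - m n) + - j)))) \<longlongrightarrow>
            Qinf * B * \<theta> j * (1 / B / Qinf)) F"
          by (intro tendsto_intros W Qinf)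
        thus "((\<lambda>n. Qinf * B * \<theta> j * (W n (nat (int (m n) + j)) / Q (nat (int (n - m n) + - j)))) \<longlongrightarrow> \<theta> j) F"
          using B Qinf by simp
        have "\<forall>\<^sub>F n in F. nat \<bar>j\<bar> \<le> m n" "\<forall>\<^sub>F n in F. nat \<bar>j\<bar> + 1 \<le> n - m n"
          using m_top nm_top unfolding filterlim_at_top by blast+
        thus "\<forall>\<^sub>F n in F. Qinf * B * \<theta> j * (W n (nat (int (m n) + j)) / Q (nat (int (n - m n) + - j)))
            = g n (nat (int (m n) + j))"
        proof eventually_elim
          case (elim n)
          hence "n - nat (int (m n) + j) = nat (int (n - m n) + - j)" "int (nat (int (m n) + j)) - int (m n) = j"
            by linarith+
          thus ?case by (simp only: g_def)
        qed
      qed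
      have "norm (g n k) \<le> h (int k - int (m n))" if "k \<le> n" for n k
      proof -
        have "norm (g n k) = norm (\<theta> (int k - int (m n))) * (norm (Qinf * B) * norm (W n k / Q (n - k)))"
          by (simp add: g_def norm_mult norm_divide mult_ac)
        also have "\<dots> \<le> norm (\<theta> (int k - int (m n))) * (norm (Qinf * B) * K)"
          by (intro mult_left_mono K(2) that) auto
        also have "\<dots> = h (int k - int (m n))"
          unfolding h_def \<theta>_def norm_theta_term[OF q w] ..
        finally show ?thesis .
      qed
      thus "\<forall>\<^sub>F n in F. \<forall>k\<le>n. norm (g n k) \<le> h (int k - int (m n))" by simp
      show "0 \<le> h j" for j using K(1) by (simp add: h_def)
      show "summable (\<lambda>i. h (int i))"
        unfolding h_def using summable_powr_quadratic[OF q, of "log q (norm w)"] by (intro summable_mult2) simp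
      show "summable (\<lambda>i. h (- int (Suc i)))"
        unfolding h_def by (intro summable_mult2 summable_powr_quadratic_neg[OF q])
    qed
  qed
  \<comment> \<open>The two products of the triple product have arguments -qw and -q/w. Since
    \<open>w\<close> carries q^(2 - 2r), they contain q^(3 - 2r) and q^(-(1 - 2r)); in the statement
    in words at the top, \<open>r\<close> has the opposite sign there.\<close>
  have J: "(\<Sum>i. \<theta> (int i) + \<theta> (- int (Suc i))) = ?J"
  proof -
    have "q powr (3 - 2 * r) = q * q powr (2 - 2 * r)" "q powr (- (1 - 2 * r)) = q / q powr (2 - 2 * r)"
      using q powr_add[of q 1 "2 - 2 * r"] powr_diff[of q 1 "2 - 2 * r"] by simp_all
    hence "- of_real q * w = of_real (q powr (3 - 2 * r)) / S"
      "- of_real q / w = of_real (q powr (- (1 - 2 * r))) * S"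
      using q S by (simp_all add: w_def)
    with jacobi_triple_product[OF q w] show ?thesis
      unfolding \<theta>_def S_def by simp
  qed
  have "((\<lambda>n. of_real (q powr (r ^ 2)) / (Qinf * B) * (\<Sum>k\<le>n. g n k)) \<longlongrightarrow>
      of_real (q powr (r ^ 2)) / (Qinf * B) * ?J) F"
    using lim unfolding J by (intro tendsto_intros)
  moreover have "\<forall>\<^sub>F n in F. of_real (q powr (r ^ 2)) / (Qinf * B) * (\<Sum>k\<le>n. g n k) = ?f n"
    using evr
  proof eventually_elim
    case (elim n)
    \<comment> \<open>Nonnegativity of the floor ensures that \<open>nat\<close> does not truncate,
      so that \<open>m n\<close> and \<open>r\<close> add up to c n / 2.\<close>
    have "0 \<le> \<lfloor>c * real n / 2\<rfloor>" using c by simp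
    hence cn: "c * real n = 2 * (real (m n) + r)"
      using elim by (simp add: frac_def m_def)
    have "?f n = (\<Sum>k\<le>n. (- (s * t2 * t3)) ^ m n *
        of_real (q powr (real n + c ^ 2 * real n ^ 2 / 4 - 2 * real (m n))) * t1 powi (int (m n) - int n) *
        ((t1 / of_real q) ^ n * ((- 1 / S) ^ k * of_real (q powr (real k ^ 2 + 2 * real k - c * real n * real k)) *
        (W n k / Q (n - k)))))"
      unfolding V_x_seq_expansion[OF q nz] sum_distrib_left S_def Q_def W_def m_def Let_def ..
    also have "\<dots> = (\<Sum>k\<le>n. of_real (q powr (r ^ 2)) * \<theta> (int k - int (m n)) * (W n k / Q (n - k)))"
    proof (rule sum.cong[OF refl])
      fix k
      define j where "j = int k - int (m n)"
      have k: "real k = real_of_int j + real (m n)" by (simp add: j_def)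
      have "c ^ 2 * real n ^ 2 / 4 = (c * real n) ^ 2 / 4" by (simp add: power_mult_distrib)
      also have "\<dots> = (real (m n) + r) ^ 2" unfolding cn by (simp add: power2_eq_square algebra_simps)
      finally have cn2: "c ^ 2 * real n ^ 2 / 4 = (real (m n) + r) ^ 2" .
      have "q powr (real n + c ^ 2 * real n ^ 2 / 4 - 2 * real (m n)) *
          q powr (real k ^ 2 + 2 * real k - c * real n * real k) =
          q powr (real n + (r ^ 2 + ((real_of_int j)\<^sup>2 + (2 - 2 * r) * real_of_int j)))"
        unfolding powr_add[symmetric] cn2 cn k by (simp add: power2_eq_square algebra_simps)
      also have "\<dots> = q ^ n * (q powr (r ^ 2) * q powr ((real_of_int j)\<^sup>2 + (2 - 2 * r) * real_of_int j))"
        using q by (simp add: powr_realpow powr_add)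
      finally have "complex_of_real (q powr (real n + c ^ 2 * real n ^ 2 / 4 - 2 * real (m n))) *
          of_real (q powr (real k ^ 2 + 2 * real k - c * real n * real k)) =
          of_real q ^ n * (of_real (q powr (r ^ 2)) * of_real (q powr ((real_of_int j)\<^sup>2 + (2 - 2 * r) * real_of_int j)))"
        by (metis of_real_mult of_real_power)
      note powr = this
      have "(- (s * t2 * t3)) ^ m n * t1 ^ m n = (- S) ^ m n"
        by (simp add: S_def mult_ac flip: power_mult_distrib)
      also have "\<dots> = 1 / (- 1 / S) ^ m n"
        using S by (simp add: power_one_over[symmetric])
      finally have pow: "(- (s * t2 * t3)) ^ m n * t1 powi (int (m n) - int n) * t1 ^ n * (- 1 / S) ^ k =
          (- 1 / S) powi j"
        using nz S by (simp add: power_int_diff j_def)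
      have "\<theta> j = (- 1 / S) powi j * of_real (q powr ((real_of_int j)\<^sup>2 + (2 - 2 * r) * real_of_int j))"
        unfolding \<theta>_def w_def by (rule theta_term_scaled) (use q S in auto)
      hence "of_real (q powr (r ^ 2)) * \<theta> j * (W n k / Q (n - k)) = ((- (s * t2 * t3)) ^ m n * t1 powi (int (m n) - int n) * t1 ^ n * (- 1 / S) ^ k) *
          (of_real q ^ n * (of_real (q powr (r ^ 2)) * of_real (q powr ((real_of_int j)\<^sup>2 + (2 - 2 * r) * real_of_int j)))) / of_real q ^ n * (W n k / Q (n - k))"
        unfolding pow using q by (simp add: mult_ac)
      also have "\<dots> = (- (s * t2 * t3)) ^ m n *
        of_real (q powr (real n + c ^ 2 * real n ^ 2 / 4 - 2 * real (m n))) * t1 powi (int (m n) - int n) *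
        ((t1 / of_real q) ^ n * ((- 1 / S) ^ k * of_real (q powr (real k ^ 2 + 2 * real k - c * real n * real k)) *
        (W n k / Q (n - k))))"
        unfolding powr[symmetric] by (simp add: power_divide mult_ac)
      finally show "(- (s * t2 * t3)) ^ m n *
        of_real (q powr (real n + c ^ 2 * real n ^ 2 / 4 - 2 * real (m n))) * t1 powi (int (m n) - int n) *
        ((t1 / of_real q) ^ n * ((- 1 / S) ^ k * of_real (q powr (real k ^ 2 + 2 * real k - c * real n * real k)) *
        (W n k / Q (n - k)))) = of_real (q powr (r ^ 2)) * \<theta> (int k - int (m n)) * (W n k / Q (n - k))"
        by (simp only: j_def)
    qed
    also have "\<dots> = of_real (q powr (r ^ 2)) / (Qinf * B) * (\<Sum>k\<le>n. g n k)"
      using Qinf B by (simp add: g_def sum_distrib_left mult_ac)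
    finally show ?case ..
  qed
  ultimately have "(?f \<longlongrightarrow> of_real (q powr (r ^ 2)) / (Qinf * B) * ?J) F"
    by (rule Lim_transform_eventually)
  thus ?thesis by (simp add: F_def Qinf_def B_def mult.assoc)
qed

section \<open>The Ramanujan function and the assembly of the three cases\<close>

lemma q_Airy_scaled:
  fixes q :: real and S :: complex
  assumes "0 < q"
  shows "q_Airy q (S * of_real (q powr (- 2))) =
    (\<Sum>k. (-1) ^ k * of_real (q powr (real k ^ 2 - 2 * real k)) * S ^ k / qpoch (of_real q) q k)"
  unfolding q_Airy_def
proof (rule suminf_cong)
  fix k :: nat
  have "q powr (real k ^ 2 - 2 * real k) = q powr real (k ^ 2) * q powr (- 2 * real k)"
    by (simp add: powr_add[symmetric])
  also have "\<dots> = q ^ (k ^ 2) * (q powr (- 2)) ^ k"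
    using assms powr_powr[of q "- 2" "real k"] powr_realpow[of "q powr (- 2)" k]
    by (simp add: powr_realpow del: of_nat_power)
  finally have "complex_of_real (q powr (real k ^ 2 - 2 * real k)) =
      of_real (q ^ (k ^ 2)) * of_real (q powr (- 2)) ^ k"
    by (metis of_real_mult of_real_power)
  thus "of_real (q ^ (k ^ 2)) / qpoch (of_real q) q k * (- (S * of_real (q powr (- 2)))) ^ k =
      (-1) ^ k * of_real (q powr (real k ^ 2 - 2 * real k)) * S ^ k / qpoch (of_real q) q k"
    by (simp add: power_minus[of "S * _"] power_mult_distrib mult_ac)
qed

theorem theorem6p1:
  fixes q c :: real and t1 t2 t3 s :: complex
  assumes "0 < q" and "q < 1"
    and "t1 \<noteq> 0" and "t2 \<noteq> 0" and "t3 \<noteq> 0" and "s \<noteq> 0"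
    and "\<And>k. qpoch (- (of_real q ^ 2) / (t1 * t2)) q k \<noteq> 0"
    and "\<And>k. qpoch (- (of_real q ^ 2) / (t1 * t3)) q k \<noteq> 0"
    and "\<And>k. qpoch (- (of_real q ^ 2) / (t2 * t3)) q k \<noteq> 0"
  shows
    "(c = 2 \<longrightarrow>
        ((\<lambda>n. (- (s * t2 * t3)) ^ n * of_real (q powr (real n ^ 2 - real n)) *
               V n (x_seq q c s n) t1 t2 t3 q)
          \<longlonglongrightarrow> 1 / (qpoch_inf (- (of_real q ^ 2) / (t1 * t2)) q *
                   qpoch_inf (- (of_real q ^ 2) / (t2 * t3)) q) *
               (\<Sum>k. (-1) ^ k * of_real (q powr (real k ^ 2 - 2 * real k)) *
                     (s * t1 * t2 * t3) ^ k / qpoch (of_real q) q k)) \<and>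
        1 / (qpoch_inf (- (of_real q ^ 2) / (t1 * t2)) q *
             qpoch_inf (- (of_real q ^ 2) / (t2 * t3)) q) *
          (\<Sum>k. (-1) ^ k * of_real (q powr (real k ^ 2 - 2 * real k)) *
                (s * t1 * t2 * t3) ^ k / qpoch (of_real q) q k)
        = q_Airy q (s * t1 * t2 * t3 * of_real (q powr (- 2))) /
            (qpoch_inf (- (of_real q ^ 2) / (t1 * t2)) q *
             qpoch_inf (- (of_real q ^ 2) / (t2 * t3)) q))
     \<and>
     (c > 2 \<longrightarrow>
        (\<lambda>n. of_real (q powr ((c - 1) * real n ^ 2 - real n)) * (- (s * t2 * t3)) ^ n *
              V n (x_seq q c s n) t1 t2 t3 q)
          \<longlonglongrightarrow> 1 / (qpoch_inf (- (of_real q ^ 2) / (t1 * t2)) q *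
                   qpoch_inf (- (of_real q ^ 2) / (t2 * t3)) q))
     \<and>
     (1 \<le> c \<and> c < 2 \<longrightarrow>
        (\<forall>r::real.
          ((\<lambda>n. let m = nat \<lfloor>c * real n / 2\<rfloor> in
                 (- (s * t2 * t3)) ^ m *
                 of_real (q powr (real n + c ^ 2 * real n ^ 2 / 4 - 2 * real m)) *
                 t1 powi (int m - int n) *
                 V n (x_seq q c s n) t1 t2 t3 q)
            \<longlongrightarrow> of_real (q powr (r ^ 2)) *
                (qpoch_inf (of_real (q ^ 2)) (q ^ 2) *
                 qpoch_inf (of_real (q powr (3 - 2 * r)) / (s * t1 * t2 * t3)) (q ^ 2) *
                 qpoch_inf (of_real (q powr (- (1 - 2 * r))) * (s * t1 * t2 * t3)) (q ^ 2)) /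
                (qpoch_inf (of_real q) q *
                 qpoch_inf (- (of_real q ^ 2) / (t1 * t2)) q *
                 qpoch_inf (- (of_real q ^ 2) / (t2 * t3)) q))
          (inf sequentially (principal {n. frac (c * real n / 2) = r}))))"
proof (intro conjI impI allI)
  note upper = V_upper_regime_tendsto[OF assms(1-9)]
  show "(\<lambda>n. (- (s * t2 * t3)) ^ n * of_real (q powr (real n ^ 2 - real n)) *
               V n (x_seq q c s n) t1 t2 t3 q)
          \<longlonglongrightarrow> 1 / (qpoch_inf (- (of_real q ^ 2) / (t1 * t2)) q *
                   qpoch_inf (- (of_real q ^ 2) / (t2 * t3)) q) *
               (\<Sum>k. (-1) ^ k * of_real (q powr (real k ^ 2 - 2 * real k)) *
                     (s * t1 * t2 * t3) ^ k / qpoch (of_real q) q k)" if "c = 2"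
    using upper[of c] that by simp
  show "1 / (qpoch_inf (- (of_real q ^ 2) / (t1 * t2)) q *
             qpoch_inf (- (of_real q ^ 2) / (t2 * t3)) q) *
          (\<Sum>k. (-1) ^ k * of_real (q powr (real k ^ 2 - 2 * real k)) *
                (s * t1 * t2 * t3) ^ k / qpoch (of_real q) q k)
        = q_Airy q (s * t1 * t2 * t3 * of_real (q powr (- 2))) /
            (qpoch_inf (- (of_real q ^ 2) / (t1 * t2)) q *
             qpoch_inf (- (of_real q ^ 2) / (t2 * t3)) q)"
    unfolding q_Airy_scaled[OF \<open>0 < q\<close>] by simp
  show "(\<lambda>n. of_real (q powr ((c - 1) * real n ^ 2 - real n)) * (- (s * t2 * t3)) ^ n *
              V n (x_seq q c s n) t1 t2 t3 q)
          \<longlonglongrightarrow> 1 / (qpoch_inf (- (of_real q ^ 2) / (t1 * t2)) q *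
                   qpoch_inf (- (of_real q ^ 2) / (t2 * t3)) q)" if "c > 2"
  proof -
    \<comment> \<open>For c > 2 the indicator leaves only the term i = 0, which equals 1.\<close>
    have "(\<Sum>i. (if c = 2 \<or> i = 0 then 1 else 0) * ((-1) ^ i * complex_of_real (q powr (real i ^ 2 - 2 * real i)) *
      (s * t1 * t2 * t3) ^ i / qpoch (of_real q) q i)) = 1"
      using that \<open>0 < q\<close> by (subst suminf_finite[of "{0}"]) auto
    with upper[of c] that show ?thesis by (simp only: mult_1_right mult_ac) (simp add: mult_ac)
  qed
qed (rule V_lower_regime_tendsto[OF assms(1-9)]; simp)

end
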